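(* Let $n\ge 2$, $\delta,\tau\in(0,1)$ and $1\le s\le\frac{n}{n-\delta}$. Let $\Omega\subset\mathbb{R}^n$ be an $s$-distance John domain with John constant $C_J\ge 1$. Then there exists a constant $C>0$ depending only on $n,\tau,s,C_J$ and $\operatorname{diam}\Omega$ such that for every $f\in L^1(\Omega)$, $$\int_\Omega |f^*-f_\Omega|\,d\mathcal{H}_\infty^{s(n-\delta)}\le C(1-\delta)\int_\Omega\int_{\{x\in\Omega:\,|x-y|<\tau d(y)\}}\frac{|f(x)-f(y)|}{|x-y|^{n+\delta}}\,dx\,dy.$$
   Context: A domain is a nonempty open connected set; $d(x)=\operatorname{dist}(x,\partial\Omega)$; $f_\Omega=\frac1{|\Omega|}\int_\Omega f\,dx$. A bounded domain $\Omega\subset\mathbb{R}^n$ is an $s$-distance John domain ($s\ge1$) with John constant $C_J\ge 1$ and John center $x_J\in\Omega$ if each $x\in\Omega$ can be joined to $x_J$ by a rectifiable curve $\gamma:[0,1]\to\Omega$, $\gamma(0)=x$, $\gamma(1)=x_J$, with $C_J\, d(\gamma(t))>|\gamma(t)-x|^s$ for all $t\in[0,1]$. A point $x\in\Omega$ is a Lebesgue point of $f\in L^1(\Omega)$ if there is $a\in\mathbb{R}$ with $\lim_{r\to0}\frac{1}{|B(x,r)|}\int_{B(x,r)}|f(y)-a|\,dy=0$; $\mathcal{L}_f$ is the set of Lebesgue points and the precise representative $f^*:\mathcal{L}_f\to\mathbb{R}$ is $f^*(x):=a$. Integrals over $\Omega$ involving $f^*$ are understood over $\mathcal{L}_f$.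 For $0<\alpha\le n$ and $A\subset\mathbb{R}^n$, the Hausdorff content is $\mathcal{H}^\alpha_\infty(A)=\inf\{\sum_{i}\omega_\alpha r_i^\alpha: A\subset\bigcup_{i}B(x_i,r_i)\}$ (countable coverings by balls), $\omega_\alpha=\pi^{\alpha/2}/\Gamma(\alpha/2+1)$. The Choquet integral is $\int_\Omega |g|\,d\mathcal{H}^\alpha_\infty:=\int_0^\infty\mathcal{H}^\alpha_\infty(\{x\in\Omega:|g(x)|>t\})\,dt$. *)

theory Defs
  imports "HOL-Analysis.Analysis"
begin

definition domain :: "'a::euclidean_space set \<Rightarrow> bool" where
  "domain \<Omega> \<longleftrightarrow> open \<Omega> \<and> connected \<Omega> \<and> \<Omega> \<noteq> {}"

definition rectifiable :: "(real \<Rightarrow> 'a::euclidean_space) \<Rightarrow> bool" where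
  "rectifiable \<gamma> \<longleftrightarrow> path \<gamma> \<and>
     (\<exists>L. \<forall>N (t :: nat \<Rightarrow> real). mono t \<and> range t \<subseteq> {0..1} \<longrightarrow>
        (\<Sum>i<N. dist (\<gamma> (t i)) (\<gamma> (t (Suc i)))) \<le> L)"

definition bdist :: "'a::euclidean_space set \<Rightarrow> 'a \<Rightarrow> real" where
  "bdist \<Omega> x = infdist x (frontier \<Omega>)"

definition john_domain_with_center ::
    "real \<Rightarrow> real \<Rightarrow> 'a::euclidean_space \<Rightarrow> 'a set \<Rightarrow> bool" where
  "john_domain_with_center s C x\<^sub>J \<Omega> \<longleftrightarrow>
     1 \<le> s \<and> 1 \<le> C \<and> domain \<Omega> \<and> bounded \<Omega> \<and> x\<^sub>J \<in> \<Omega> \<and>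
     (\<forall>x\<in>\<Omega>. \<exists>\<gamma>. rectifiable \<gamma> \<and> path_image \<gamma> \<subseteq> \<Omega> \<and>
        pathstart \<gamma> = x \<and> pathfinish \<gamma> = x\<^sub>J \<and>
        (\<forall>t\<in>{0..1}. C * bdist \<Omega> (\<gamma> t) > dist (\<gamma> t) x powr s))"

definition john_domain :: "real \<Rightarrow> real \<Rightarrow> 'a::euclidean_space set \<Rightarrow> bool" where
  "john_domain s C \<Omega> \<longleftrightarrow> (\<exists>x\<^sub>J. john_domain_with_center s C x\<^sub>J \<Omega>)"

definition mean_value :: "'a::euclidean_space set \<Rightarrow> ('a \<Rightarrow> real) \<Rightarrow> real" where
  "mean_value \<Omega> f = (LINT x:\<Omega>|lebesgue. f x) / measure lebesgue \<Omega>"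

(* Functions on \<Omega> are represented by total functions. For x in the open set \<Omega> the limit
   below only involves balls inside \<Omega>, so the values outside \<Omega> play no role. *)
definition is_lebesgue_value :: "('a::euclidean_space \<Rightarrow> real) \<Rightarrow> 'a \<Rightarrow> real \<Rightarrow> bool" where
  "is_lebesgue_value f x a \<longleftrightarrow>
     ((\<lambda>r. (LINT y:ball x r|lebesgue. \<bar>f y - a\<bar>) / measure lebesgue (ball x r)) \<longlongrightarrow> 0)
       (at_right 0)"

definition lebesgue_points :: "'a::euclidean_space set \<Rightarrow> ('a \<Rightarrow> real) \<Rightarrow> 'a set" where
  "lebesgue_points \<Omega> f = {x\<in>\<Omega>. \<exists>a. is_lebesgue_value f x a}"

definition precise_rep :: "('a::euclidean_space \<Rightarrow> real) \<Rightarrow> 'a \<Rightarrow> real" where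
  "precise_rep f x = (THE a. is_lebesgue_value f x a)"

(* Radius 0 is allowed (the ball is then empty and, for \<alpha> > 0, contributes 0), so that
   sequences of balls also encode the finite coverings. *)
definition hausdorff_content :: "real \<Rightarrow> 'a::euclidean_space set \<Rightarrow> ennreal" where
  "hausdorff_content \<alpha> A =
     Inf {(\<Sum>i. ennreal (unit_ball_vol \<alpha> * r i powr \<alpha>)) | (c :: nat \<Rightarrow> 'a) (r :: nat \<Rightarrow> real).
            (\<forall>i. 0 \<le> r i) \<and> A \<subseteq> (\<Union>i. ball (c i) (r i))}"

definition choquet_integral ::
    "real \<Rightarrow> 'a::euclidean_space set \<Rightarrow> ('a \<Rightarrow> real) \<Rightarrow> ennreal" where
  "choquet_integral \<alpha> E g =
     (\<integral>\<^sup>+t\<in>{0..}. hausdorff_content \<alpha> {x\<in>E. \<bar>g x\<bar> > t} \<partial>lborel)"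

end

theory Submission
  imports Defs
begin

text \<open>The estimate is a boxing inequality integrated over superlevel sets. Let \<open>E\<close> be a set of
  density at most one half in the ball around the John center. Moving from a point of high density
  of \<open>E\<close> to the center, first by enlarging balls and then along the John curve, one meets a ball
  \<open>B(c, r)\<close> with \<open>r \<le> \<tau> d(c) / 4\<close> in which \<open>E\<close> has density exactly one half; the John condition
  places the starting point within a constant times \<open>r powr (1 / s)\<close> of \<open>c\<close>. Cutting the segments
  that join \<open>E \<inter> B\<close> to \<open>B - E\<close> into \<open>N\<close> equal pieces shows that the pairs at distance below \<open>\<rho>\<close> across
  \<open>E\<close> have measure at least a constant times \<open>r ^ (n - 1) * \<rho> ^ (n + 1)\<close>, and integrating against the layer
  cake of the kernel gives \<open>r powr (n - \<delta>) \<le> K * (1 - \<delta>)\<close> times the energy of \<open>E\<close> in \<open>B\<close>. Vitali's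
  covering lemma turns this into a bound of \<open>s (n - \<delta>)\<close>-content by energy. It is applied to the
  superlevel sets of \<open>f\<close> and \<open>- f\<close> beyond a median \<open>m\<close> of \<open>f\<close> on the ball around the center; the
  coarea formula sums the energies, and \<open>m\<close> is replaced by the mean value since Lebesgue measure
  is at most the \<open>n\<close>-dimensional content.\<close>

section \<open>Pairs of nearby points across a set\<close>

text \<open>The factor \<open>1 - \<delta>\<close> is the crux. The layer cake weight of the kernel
  is of order \<rho> powr (- n - \<delta> - 1), so a pair count of order \<rho> ^ (n + 1) leaves
  \<rho> powr (- \<delta>), whose integral up to \<open>r\<close> is r powr (1 - \<delta>) / (1 -
  \<delta>). An estimate at the single scale \<open>r\<close> would give the same power of
  \<open>r\<close> without the gain, since for \<delta> near 1 the energy sits at small scales. The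
  bound r \<le> \<tau> d(c) / 4 puts all pairs of points of the ball into the region of integration,
  so energies of disjoint balls add up. A covering radius of order r powr (1 / s) raised to the
  power s (n - \<delta>) returns r powr (n - \<delta>), which explains the exponent of the content.
  A median is needed first because nothing makes the superlevel sets beyond the mean value sparse in
  the central ball. The upper bound on \<open>s\<close> says s (n - \<delta>) \<le> n, so the same
  boxing argument also controls the n-dimensional content, hence Lebesgue measure and the gap
  between mean and median. Every constant has to be uniform in \<delta>, although the exponent of
  the content moves with \<delta>.\<close>

lemma nn_integral_lborel_affine:
  fixes F :: "'a::euclidean_space \<Rightarrow> ennreal"
  assumes [measurable]: "F \<in> borel_measurable borel" and "c \<noteq> 0"
  shows "(\<integral>\<^sup>+x. F x \<partial>lborel) = ennreal (\<bar>c\<bar> ^ DIM('a)) * (\<integral>\<^sup>+x. F (t + c *\<^sub>R x) \<partial>lborel)"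
  by (subst lborel_affine[OF assms(2), of t])
     (simp add: nn_integral_density nn_integral_distr nn_integral_cmult ennreal_power)

text \<open>In the variables \<open>x\<close> and \<open>h = y - x\<close> the two points are
  \<open>x + a h\<close> and \<open>x + b h\<close>. Translating \<open>x\<close> by
  \<open>a h\<close> turns them into \<open>x\<close> and \<open>x + (b - a) h\<close>, and scaling
  \<open>h\<close> contributes the Jacobian. Only the gap \<open>b - a\<close> enters, not the
  position on the segment.\<close>

lemma nn_integral_segment_points:
  fixes F :: "'a::euclidean_space \<Rightarrow> 'a \<Rightarrow> ennreal"
  assumes [measurable]: "case_prod F \<in> borel_measurable (borel \<Otimes>\<^sub>M borel)" and ab: "a < b"
  shows "(\<integral>\<^sup>+x. \<integral>\<^sup>+y. F x y \<partial>lborel \<partial>lborel) =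
    ennreal ((b - a) ^ DIM('a)) *
      (\<integral>\<^sup>+x. \<integral>\<^sup>+y. F (x + a *\<^sub>R (y - x)) (x + b *\<^sub>R (y - x)) \<partial>lborel \<partial>lborel)"
proof -
  have [measurable]: "case_prod F \<in> borel_measurable (borel \<Otimes>\<^sub>M lborel)"
    "case_prod F \<in> borel_measurable (lborel \<Otimes>\<^sub>M lborel)"
    using assms(1) by (simp_all cong: measurable_cong_sets)
  have "(\<integral>\<^sup>+x. \<integral>\<^sup>+y. F (x + a *\<^sub>R (y - x)) (x + b *\<^sub>R (y - x)) \<partial>lborel \<partial>lborel) =
     (\<integral>\<^sup>+x. \<integral>\<^sup>+h. F (x + a *\<^sub>R h) (x + b *\<^sub>R h) \<partial>lborel \<partial>lborel)"
  proof (rule nn_integral_cong)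
    fix x :: 'a
    show "(\<integral>\<^sup>+y. F (x + a *\<^sub>R (y - x)) (x + b *\<^sub>R (y - x)) \<partial>lborel) =
      (\<integral>\<^sup>+h. F (x + a *\<^sub>R h) (x + b *\<^sub>R h) \<partial>lborel)"
      by (subst nn_integral_lborel_affine[where c=1 and t=x]) auto
  qed
  also have "\<dots> = (\<integral>\<^sup>+h. \<integral>\<^sup>+x. F (x + a *\<^sub>R h) (x + b *\<^sub>R h) \<partial>lborel \<partial>lborel)"
    by (rule lborel_pair.Fubini') measurable
  also have "\<dots> = (\<integral>\<^sup>+h. \<integral>\<^sup>+x. F x (x + (b - a) *\<^sub>R h) \<partial>lborel \<partial>lborel)"
  proof (rule nn_integral_cong)
    fix h :: 'a
    show "(\<integral>\<^sup>+x. F (x + a *\<^sub>R h) (x + b *\<^sub>R h) \<partial>lborel) = (\<integral>\<^sup>+x. F x (x + (b - a) *\<^sub>R h) \<partial>lborel)"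
      by (subst (2) nn_integral_lborel_affine[where c=1 and t="a *\<^sub>R h"])
         (auto simp: algebra_simps)
  qed
  also have "\<dots> = (\<integral>\<^sup>+x. \<integral>\<^sup>+h. F x (x + (b - a) *\<^sub>R h) \<partial>lborel \<partial>lborel)"
    by (rule lborel_pair.Fubini'[symmetric]) measurable
  finally have eq: "(\<integral>\<^sup>+x. \<integral>\<^sup>+y. F (x + a *\<^sub>R (y - x)) (x + b *\<^sub>R (y - x)) \<partial>lborel \<partial>lborel)
    = (\<integral>\<^sup>+x. \<integral>\<^sup>+h. F x (x + (b - a) *\<^sub>R h) \<partial>lborel \<partial>lborel)" .
  have "(\<integral>\<^sup>+x. \<integral>\<^sup>+y. F x y \<partial>lborel \<partial>lborel)
    = (\<integral>\<^sup>+x. ennreal ((b - a) ^ DIM('a)) * (\<integral>\<^sup>+h. F x (x + (b - a) *\<^sub>R h) \<partial>lborel) \<partial>lborel)"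
  proof (rule nn_integral_cong)
    fix x :: 'a
    show "(\<integral>\<^sup>+y. F x y \<partial>lborel) = ennreal ((b - a) ^ DIM('a)) * (\<integral>\<^sup>+h. F x (x + (b - a) *\<^sub>R h) \<partial>lborel)"
      using ab by (subst nn_integral_lborel_affine[where c="b - a" and t=x]) auto
  qed
  also have "\<dots> = ennreal ((b - a) ^ DIM('a)) * (\<integral>\<^sup>+x. \<integral>\<^sup>+h. F x (x + (b - a) *\<^sub>R h) \<partial>lborel \<partial>lborel)"
    by (rule nn_integral_cmult) measurable
  finally show ?thesis
    by (simp only: eq)
qed

lemma nat_crossing_index:
  fixes P :: "nat \<Rightarrow> bool"
  assumes "P 0" "\<not> P N"
  obtains j where "j < N" "P j" "\<not> P (Suc j)"
proof -
  have "\<exists>j<N. P j \<and> \<not> P (Suc j)"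
    using assms(2)
  proof (induction N)
    case (Suc N)
    then show ?case
      by (cases "P N") (auto intro: less_SucI)
  qed (use assms in auto)
  then show ?thesis
    using that by blast
qed

text \<open>Of the \<open>N + 1\<close> equidistant points of a segment from \<open>E \<inter> B\<close> to \<open>B - E\<close> some consecutive pair
  crosses from \<open>E\<close> to its complement. The map from the end points to the \<open>j\<close>-th such pair is linear
  with Jacobian \<open>(1 / N) ^ DIM('a)\<close>, and there are \<open>N\<close> of these maps.\<close>

lemma emeasure_mult_le_close_pairs:
  fixes B E :: "'a::euclidean_space set"
  assumes [measurable]: "B \<in> sets borel" "E \<in> sets borel" and "convex B" and "0 < N"
    and diam: "\<And>x y. x \<in> B \<Longrightarrow> y \<in> B \<Longrightarrow> dist x y < real N * \<rho>"
  shows "emeasure lborel (E \<inter> B) * emeasure lborel (B - E) \<le>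
    ennreal (real N ^ (DIM('a) + 1)) *
      (\<integral>\<^sup>+x. \<integral>\<^sup>+y. indicator (E \<inter> B) x * indicator (B - E) y * indicator {..<\<rho>} (dist x y)
         \<partial>lborel \<partial>lborel)"
proof -
  define F :: "'a \<Rightarrow> 'a \<Rightarrow> ennreal" where
    "F x y = indicator (E \<inter> B) x * indicator (B - E) y * indicator {..<\<rho>} (dist x y)" for x y
  define p where "p j x y = x + (real j / real N) *\<^sub>R (y - x)" for j and x y :: 'a
  have [measurable]: "case_prod F \<in> borel_measurable (borel \<Otimes>\<^sub>M borel)"
    "case_prod F \<in> borel_measurable (lborel \<Otimes>\<^sub>M lborel)"
    unfolding F_def by measurable
  have pt: "indicator (E \<inter> B) x * indicator (B - E) y \<le> (\<Sum>j<N. F (p j x y) (p (Suc j) x y))"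
    for x y :: 'a
  proof (cases "x \<in> E \<inter> B \<and> y \<in> B - E")
    case True
    have inB: "p j x y \<in> B" if "j \<le> N" for j
    proof -
      have "p j x y = (1 - real j / real N) *\<^sub>R x + (real j / real N) *\<^sub>R y"
        by (simp add: p_def algebra_simps)
      also have "\<dots> \<in> B"
        using True that \<open>0 < N\<close> by (intro convexD[OF \<open>convex B\<close>]) auto
      finally show ?thesis .
    qed
    have "p 0 x y \<in> E" "p N x y \<notin> E"
      using True \<open>0 < N\<close> by (auto simp: p_def)
    then obtain j where j: "j < N" "p j x y \<in> E" "p (Suc j) x y \<notin> E"
      by (rule nat_crossing_index)
    have "p (Suc j) x y - p j x y = (1 / real N) *\<^sub>R (y - x)"
      by (simp add: p_def add_divide_distrib scaleR_left_distrib)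
    then have "dist (p j x y) (p (Suc j) x y) = dist x y / real N"
      using \<open>0 < N\<close> by (simp add: dist_norm norm_minus_commute[of "p j x y"] norm_minus_commute[of x])
    also have "\<dots> < \<rho>"
      using diam[of x y] True \<open>0 < N\<close> by (simp add: divide_less_eq mult.commute)
    finally have "F (p j x y) (p (Suc j) x y) = 1"
      using j inB[of j] inB[of "Suc j"] by (simp add: F_def)
    moreover have "F (p j x y) (p (Suc j) x y) \<le> (\<Sum>j<N. F (p j x y) (p (Suc j) x y))"
      using j by (intro member_le_sum) auto
    ultimately show ?thesis
      using True by simp
  qed (auto simp: indicator_def)
  have [measurable]: "(\<lambda>(x, y). F (p j x y) (p k x y)) \<in> borel_measurable (borel \<Otimes>\<^sub>M borel)"
    "(\<lambda>(x, y). F (p j x y) (p k x y)) \<in> borel_measurable (lborel \<Otimes>\<^sub>M lborel)" for j k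
    unfolding p_def by measurable
  have term_eq: "(\<integral>\<^sup>+x. \<integral>\<^sup>+y. F (p j x y) (p (Suc j) x y) \<partial>lborel \<partial>lborel) =
     ennreal (real N ^ DIM('a)) * (\<integral>\<^sup>+x. \<integral>\<^sup>+y. F x y \<partial>lborel \<partial>lborel)" for j
  proof -
    let ?I = "\<integral>\<^sup>+x. \<integral>\<^sup>+y. F (p j x y) (p (Suc j) x y) \<partial>lborel \<partial>lborel"
    have "(\<integral>\<^sup>+x. \<integral>\<^sup>+y. F x y \<partial>lborel \<partial>lborel) = ennreal ((1 / real N) ^ DIM('a)) * ?I"
      unfolding p_def
      using nn_integral_segment_points[of F "real j / real N" "real (Suc j) / real N"] \<open>0 < N\<close>
      by (simp add: divide_strict_right_mono add_divide_distrib)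
    then have "ennreal (real N ^ DIM('a)) * (\<integral>\<^sup>+x. \<integral>\<^sup>+y. F x y \<partial>lborel \<partial>lborel)
       = ennreal (real N ^ DIM('a) * (1 / real N) ^ DIM('a)) * ?I"
      by (simp add: ennreal_mult mult.assoc)
    then show ?thesis
      using \<open>0 < N\<close> by (simp add: power_mult_distrib[symmetric])
  qed
  have "emeasure lborel (E \<inter> B) * emeasure lborel (B - E)
    = (\<integral>\<^sup>+x. \<integral>\<^sup>+y. indicator (E \<inter> B) x * indicator (B - E) y \<partial>lborel \<partial>lborel)"
    by (simp add: nn_integral_cmult nn_integral_multc)
  also have "\<dots> \<le> (\<integral>\<^sup>+x. \<integral>\<^sup>+y. (\<Sum>j<N. F (p j x y) (p (Suc j) x y)) \<partial>lborel \<partial>lborel)"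
    by (intro nn_integral_mono pt)
  also have "\<dots> = (\<Sum>j<N. \<integral>\<^sup>+x. \<integral>\<^sup>+y. F (p j x y) (p (Suc j) x y) \<partial>lborel \<partial>lborel)"
    by (simp add: nn_integral_sum)
  also have "\<dots> = ennreal (real N ^ (DIM('a) + 1)) * (\<integral>\<^sup>+x. \<integral>\<^sup>+y. F x y \<partial>lborel \<partial>lborel)"
    by (simp add: term_eq ennreal_mult mult.assoc ennreal_of_nat_eq_real_of_nat)
  finally show ?thesis
    by (simp add: F_def)
qed

section \<open>Layer cake of the kernel and the energy of a ball of density one half\<close>

lemma borel_measurable_indicator_lessThan [measurable]:
  fixes f g :: "'a \<Rightarrow> real"
  assumes [measurable]: "f \<in> borel_measurable M" "g \<in> borel_measurable M"
  shows "(\<lambda>x. indicator {..<g x} (f x) :: ennreal) \<in> borel_measurable M"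
proof -
  have "(\<lambda>x. indicator {..<g x} (f x) :: ennreal) = (\<lambda>x. if f x < g x then 1 else 0)"
    by auto
  then show ?thesis
    by simp
qed

text \<open>This writes the kernel as a superposition over scales \<open>\<rho>\<close> of the
  condition \<open>h < \<rho>\<close>, which reduces the energy to counts of pairs at distance below
  \<open>\<rho>\<close>.\<close>

lemma nn_integral_powr_at_top:
  fixes h q :: real
  assumes "0 < h" "0 < q"
  shows "(\<integral>\<^sup>+\<rho>. ennreal (q * \<rho> powr (- q - 1)) * indicator {..<\<rho>} h \<partial>lborel) = ennreal (1 / h powr q)"
proof -
  have "((\<lambda>\<rho>. \<rho> powr (- q - 1)) has_integral (h powr (- q) / q)) {h..}"
    using has_integral_powr_to_inf[of "- q - 1" h] assms by simp
  then have I: "(\<integral>\<^sup>+\<rho>. ennreal (indicator {h..} \<rho> * \<rho> powr (- q - 1)) \<partial>lborel) = ennreal (h powr (- q) / q)"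
    by (intro nn_integral_has_integral_lebesgue) auto
  \<comment> \<open>The strict condition \<open>h < \<rho>\<close> and the closed half-line
    \<open>{h..}\<close> differ only at \<open>\<rho> = h\<close>, a null set.\<close>
  have "(\<integral>\<^sup>+\<rho>. ennreal (q * \<rho> powr (- q - 1)) * indicator {..<\<rho>} h \<partial>lborel)
    = (\<integral>\<^sup>+\<rho>. ennreal q * ennreal (indicator {h..} \<rho> * \<rho> powr (- q - 1)) \<partial>lborel)"
    using assms AE_lborel_singleton[of h]
    by (intro nn_integral_cong_AE) (auto elim!: eventually_mono simp: ennreal_mult[symmetric] indicator_def)
  also have "\<dots> = ennreal (q * (h powr (- q) / q))"
    using assms by (subst nn_integral_cmult) (simp, subst I, simp add: ennreal_mult[symmetric])
  finally show ?thesis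
    using assms by (simp add: powr_minus divide_inverse)
qed

text \<open>The blow-up of this integral as \<open>\<delta>\<close> tends to 1 is the source of the
  factor \<open>1 - \<delta>\<close> in the final estimate.\<close>

lemma nn_integral_powr_from_0:
  fixes r \<delta> :: real
  assumes "0 < r" "\<delta> < 1"
  shows "(\<integral>\<^sup>+\<rho>. ennreal (indicator {0..r} \<rho> * \<rho> powr (- \<delta>)) \<partial>lborel) = ennreal (r powr (1 - \<delta>) / (1 - \<delta>))"
  using has_integral_powr_from_0[of "- \<delta>" r] assms
  by (intro nn_integral_has_integral_lebesgue) (auto simp: add.commute)

lemma close_pairs_lower_bound:
  fixes E :: "'a::euclidean_space set" and c :: 'a and r \<rho> :: real
  defines "V \<equiv> unit_ball_vol (real DIM('a)) * r ^ DIM('a)"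
  assumes [measurable]: "E \<in> sets borel" and \<rho>: "0 < \<rho>" "\<rho> \<le> r"
    and half: "measure lborel (E \<inter> ball c r) = measure lborel (ball c r) / 2"
  shows "ennreal ((V / 2) ^ 2 * (\<rho> / (3 * r)) ^ (DIM('a) + 1)) \<le>
    (\<integral>\<^sup>+x. \<integral>\<^sup>+y. indicator (E \<inter> ball c r) x * indicator (ball c r - E) y * indicator {..<\<rho>} (dist x y)
         \<partial>lborel \<partial>lborel)"
    (is "_ \<le> ?A")
proof -
  let ?B = "ball c r"
  \<comment> \<open>Chords of the ball are shorter than \<open>2 * r\<close>, so pieces are shorter
    than \<open>\<rho>\<close> once \<open>2 * r \<le> N * \<rho>\<close>. Rounding up adds at most
    1, which \<open>\<rho> \<le> r\<close> absorbs into \<open>3 * r / \<rho>\<close>.\<close>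
  define N where "N = nat \<lceil>2 * r / \<rho>\<rceil>"
  have r: "0 < r" using \<rho> by simp
  have V: "V \<ge> 0" using r by (simp add: V_def)
  have Npos: "0 < N" using \<rho> r by (simp add: N_def)
  have Nge: "2 * r \<le> real N * \<rho>"
    using \<rho> real_nat_ceiling_ge[of "2 * r / \<rho>"] unfolding N_def by (simp only: divide_le_eq split: if_splits)
  have "real N \<le> 2 * r / \<rho> + 1"
    using \<rho> r by (simp add: N_def of_nat_nat)
  also have "\<dots> \<le> 3 * r / \<rho>"
    using \<rho> by (simp add: field_simps)
  finally have Nle: "real N \<le> 3 * r / \<rho>" .
  have VB: "measure lborel ?B = V"
    using r by (simp add: V_def content_ball)
  have "emeasure lborel ?B \<noteq> \<infinity>"
    using emeasure_bounded_finite[of ?B] by simp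
  then have fm: "?B \<in> fmeasurable lborel" "E \<inter> ?B \<in> fmeasurable lborel"
    using fmeasurableI[of ?B lborel] fmeasurableI2[of ?B lborel "E \<inter> ?B"] by (auto simp: less_top)
  have "measure lborel (?B - E) = measure lborel ?B - measure lborel (E \<inter> ?B)"
    using fm by (subst measure_Diff[symmetric]) (auto intro!: arg_cong[where f="measure lborel"] simp: fmeasurable_def)
  then have m: "measure lborel (E \<inter> ?B) = V / 2" "measure lborel (?B - E) = V / 2"
    using half VB by auto
  have e: "emeasure lborel (E \<inter> ?B) = ennreal (V / 2)" "emeasure lborel (?B - E) = ennreal (V / 2)"
    using emeasure_eq_measure2[OF fm(2)] emeasure_eq_measure2[OF fmeasurable_Diff[OF fm(1), of E]] m
    by simp_all
  have "dist x y < real N * \<rho>" if "x \<in> ?B" "y \<in> ?B" for x y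
    using that dist_triangle_less_add[of x c r y r] Nge by (auto simp: dist_commute)
  then have "ennreal (V / 2) * ennreal (V / 2) \<le> ennreal (real N ^ (DIM('a) + 1)) * ?A"
    using emeasure_mult_le_close_pairs[of ?B E N \<rho>] Npos
    unfolding e by (simp del: power_Suc)
  then have "ennreal ((V / 2) ^ 2) \<le> ennreal (real N ^ (DIM('a) + 1)) * ?A"
    using ennreal_mult[of "V / 2" "V / 2"] V by (simp only: power2_eq_square)
  also have "\<dots> \<le> ennreal ((3 * r / \<rho>) ^ (DIM('a) + 1)) * ?A"
    using Nle by (intro mult_right_mono ennreal_leI power_mono) auto
  finally have "ennreal ((\<rho> / (3 * r)) ^ (DIM('a) + 1)) * ennreal ((V / 2) ^ 2)
     \<le> ennreal ((\<rho> / (3 * r)) ^ (DIM('a) + 1)) * (ennreal ((3 * r / \<rho>) ^ (DIM('a) + 1)) * ?A)"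
    by (rule mult_left_mono) simp
  also have "\<dots> = ennreal ((\<rho> / (3 * r)) ^ (DIM('a) + 1) * (3 * r / \<rho>) ^ (DIM('a) + 1)) * ?A"
    using \<rho> r by (subst ennreal_mult) (simp_all only: mult.assoc zero_le_power divide_nonneg_pos
      mult_nonneg_nonneg less_imp_le zero_less_mult_iff zero_less_numeral simp_thms)
  also have "(\<rho> / (3 * r)) ^ (DIM('a) + 1) * (3 * r / \<rho>) ^ (DIM('a) + 1) = 1"
    unfolding power_mult_distrib[symmetric] using \<rho> r by simp
  finally have "ennreal ((\<rho> / (3 * r)) ^ (DIM('a) + 1)) * ennreal ((V / 2) ^ 2) \<le> ?A"
    by (simp only: ennreal_1 mult_1)
  then show ?thesis
    using \<rho> r by (subst mult.commute) (simp only: ennreal_mult'' zero_le_power2)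
qed

text \<open>The pair count is integrated against the layer cake weight over the scales
  \<open>\<rho> \<le> r\<close> only; the exponents add up to
  \<open>(n - 1) + (1 - \<delta>)\<close>. In \<open>\<beta>\<close> the square comes from the two
  halves of the ball and the power of 3 from the number of pieces of a chord.\<close>

lemma half_density_ball_energy:
  fixes E :: "'a::euclidean_space set" and c :: 'a and r \<delta> :: real
  defines "\<beta> \<equiv> (unit_ball_vol (real DIM('a)) / 2) ^ 2 / 3 ^ (DIM('a) + 1)"
  assumes [measurable]: "E \<in> sets borel" and r: "0 < r" and \<delta>: "0 < \<delta>" "\<delta> < 1"
    and half: "measure lborel (E \<inter> ball c r) = measure lborel (ball c r) / 2"
  shows "ennreal (\<beta> * r powr (real DIM('a) - \<delta>)) \<le> ennreal (1 - \<delta>) *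
    (\<integral>\<^sup>+y\<in>ball c r. (\<integral>\<^sup>+x\<in>ball c r.
       ennreal (\<bar>indicator E x - indicator E y\<bar> / dist x y powr (real DIM('a) + \<delta>)) \<partial>lborel) \<partial>lborel)"
proof -
  let ?B = "ball c r" and ?n = "real DIM('a)"
  let ?q = "?n + \<delta>"
  have q: "0 < ?q" using \<delta> by (simp add: add_nonneg_pos)
  define J :: "'a \<Rightarrow> 'a \<Rightarrow> ennreal" where "J x y = indicator (E \<inter> ?B) x * indicator (?B - E) y" for x y
  define W :: "real \<Rightarrow> ennreal" where "W \<rho> = ennreal (?q * \<rho> powr (- ?q - 1)) * indicator {0<..} \<rho>" for \<rho>
  define A where "A \<rho> = (\<integral>\<^sup>+x. \<integral>\<^sup>+y. J x y * indicator {..<\<rho>} (dist x y) \<partial>lborel \<partial>lborel)" for \<rho>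
  define V where "V = unit_ball_vol ?n * r ^ DIM('a)"
  have [measurable]: "?B \<in> sets borel"
    by simp
  have [measurable]: "(\<lambda>(x, y). J x y) \<in> borel_measurable (borel \<Otimes>\<^sub>M borel)"
    unfolding J_def by measurable
  have [measurable]: "W \<in> borel_measurable borel"
    unfolding W_def by measurable
  \<comment> \<open>Only pairs with \<open>y\<close> in \<open>E\<close> and \<open>x\<close>
    outside are counted; pairs of the opposite orientation are discarded, hence an
    inequality.\<close>
  have lay: "J y x * (\<integral>\<^sup>+\<rho>. W \<rho> * indicator {..<\<rho>} (dist y x) \<partial>lborel) \<le>
    ennreal (\<bar>indicator E x - indicator E y\<bar> / dist x y powr ?q) * indicator ?B x * indicator ?B y" for x y
  proof (cases "y \<in> E \<inter> ?B \<and> x \<in> ?B - E")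
    case True
    then have "0 < dist y x" by auto
    have "(\<integral>\<^sup>+\<rho>. W \<rho> * indicator {..<\<rho>} (dist y x) \<partial>lborel) =
      (\<integral>\<^sup>+\<rho>. ennreal (?q * \<rho> powr (- ?q - 1)) * indicator {..<\<rho>} (dist y x) \<partial>lborel)"
    proof (rule nn_integral_cong)
      fix \<rho> :: real
      show "W \<rho> * indicator {..<\<rho>} (dist y x) =
        ennreal (?q * \<rho> powr (- ?q - 1)) * indicator {..<\<rho>} (dist y x)"
        using less_trans[OF \<open>0 < dist y x\<close>, of \<rho>] by (auto simp: W_def indicator_def)
    qed
    also have "\<dots> = ennreal (1 / dist y x powr ?q)"
      using \<open>0 < dist y x\<close> q by (rule nn_integral_powr_at_top)
    finally show ?thesis
      using True by (simp add: J_def dist_commute)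
  qed (auto simp: J_def indicator_def)
  have "(\<integral>\<^sup>+\<rho>. W \<rho> * A \<rho> \<partial>lborel)
    = (\<integral>\<^sup>+\<rho>. \<integral>\<^sup>+y. \<integral>\<^sup>+x. W \<rho> * (J y x * indicator {..<\<rho>} (dist y x)) \<partial>lborel \<partial>lborel \<partial>lborel)"
    unfolding A_def by (simp add: nn_integral_cmult)
  also have "\<dots> = (\<integral>\<^sup>+y. \<integral>\<^sup>+\<rho>. \<integral>\<^sup>+x. W \<rho> * (J y x * indicator {..<\<rho>} (dist y x)) \<partial>lborel \<partial>lborel \<partial>lborel)"
    by (rule lborel_pair.Fubini') measurable
  also have "\<dots> = (\<integral>\<^sup>+y. \<integral>\<^sup>+x. \<integral>\<^sup>+\<rho>. W \<rho> * (J y x * indicator {..<\<rho>} (dist y x)) \<partial>lborel \<partial>lborel \<partial>lborel)"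
    by (rule nn_integral_cong, rule lborel_pair.Fubini') measurable
  also have "\<dots> = (\<integral>\<^sup>+y. \<integral>\<^sup>+x. J y x * (\<integral>\<^sup>+\<rho>. W \<rho> * indicator {..<\<rho>} (dist y x) \<partial>lborel) \<partial>lborel \<partial>lborel)"
    by (subst nn_integral_cmult[symmetric]) (simp_all add: ac_simps)
  also have "\<dots> \<le> (\<integral>\<^sup>+y. \<integral>\<^sup>+x. ennreal (\<bar>indicator E x - indicator E y\<bar> / dist x y powr ?q) * indicator ?B x * indicator ?B y \<partial>lborel \<partial>lborel)"
    by (intro nn_integral_mono lay)
  also have "\<dots> = (\<integral>\<^sup>+y\<in>?B. (\<integral>\<^sup>+x\<in>?B.
       ennreal (\<bar>indicator E x - indicator E y\<bar> / dist x y powr ?q) \<partial>lborel) \<partial>lborel)"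
    by (simp add: nn_integral_multc)
  finally have up: "(\<integral>\<^sup>+\<rho>. W \<rho> * A \<rho> \<partial>lborel) \<le> \<dots>" .
  have low: "ennreal (\<beta> * r powr (?n - 1)) * ennreal (indicator {0..r} \<rho> * \<rho> powr (- \<delta>)) \<le> W \<rho> * A \<rho>" for \<rho>
  proof (cases "0 < \<rho> \<and> \<rho> \<le> r")
    case True
    \<comment> \<open>The layer cake density carries the factor \<open>?q\<close>. Bounding it below
      by 1 keeps \<open>\<beta>\<close> independent of \<open>\<delta>\<close>.\<close>
    have "1 \<le> ?q" using \<delta> DIM_positive[where 'a='a] by linarith
    have "\<beta> * r powr (?n - 1) * \<rho> powr (- \<delta>) = \<rho> powr (- ?q - 1) * ((V / 2) ^ 2 * (\<rho> / (3 * r)) ^ (DIM('a) + 1))"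
    proof -
      have "\<rho> powr (- ?q - 1) * \<rho> ^ (DIM('a) + 1) = \<rho> powr (- \<delta>)"
        using True by (simp add: powr_realpow[symmetric] powr_add[symmetric] del: power_Suc)
      moreover have "(r ^ DIM('a)) ^ 2 / r ^ (DIM('a) + 1) = r powr (?n - 1)"
        using r by (simp add: powr_realpow[symmetric] powr_diff[symmetric] powr_powr powr_mult_base power_mult[symmetric] del: power_Suc)
      moreover have "\<rho> powr (- ?q - 1) * ((V / 2) ^ 2 * (\<rho> / (3 * r)) ^ (DIM('a) + 1))
        = \<beta> * ((r ^ DIM('a)) ^ 2 / r ^ (DIM('a) + 1)) * (\<rho> powr (- ?q - 1) * \<rho> ^ (DIM('a) + 1))"
        unfolding \<beta>_def V_def by (simp add: power_divide power_mult_distrib mult_ac)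
      ultimately show ?thesis
        by simp
    qed
    also have "\<dots> \<le> ?q * \<rho> powr (- ?q - 1) * ((V / 2) ^ 2 * (\<rho> / (3 * r)) ^ (DIM('a) + 1))"
      using \<open>1 \<le> ?q\<close> True r by (intro mult_right_mono) auto
    finally have "ennreal (\<beta> * r powr (?n - 1) * \<rho> powr (- \<delta>)) \<le>
      ennreal (?q * \<rho> powr (- ?q - 1)) * ennreal ((V / 2) ^ 2 * (\<rho> / (3 * r)) ^ (DIM('a) + 1))"
      using q by (subst ennreal_mult[symmetric]) (auto intro!: ennreal_leI mult_nonneg_nonneg simp: r less_imp_le True)
    also have "\<dots> \<le> ennreal (?q * \<rho> powr (- ?q - 1)) * A \<rho>"
      unfolding A_def J_def V_def using close_pairs_lower_bound[of E \<rho> r c] True half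
      by (intro mult_left_mono) auto
    finally show ?thesis
      using True by (simp add: W_def \<beta>_def ennreal_mult[symmetric])
  qed (auto simp: indicator_def not_less)
  have "ennreal (\<beta> * r powr (?n - 1)) * ennreal (r powr (1 - \<delta>) / (1 - \<delta>)) \<le> (\<integral>\<^sup>+\<rho>. W \<rho> * A \<rho> \<partial>lborel)"
    unfolding nn_integral_powr_from_0[OF r \<delta>(2), symmetric]
    by (subst nn_integral_cmult[symmetric]) (auto intro!: nn_integral_mono low)
  also note up
  finally have "ennreal (1 - \<delta>) * (ennreal (\<beta> * r powr (?n - 1)) * ennreal (r powr (1 - \<delta>) / (1 - \<delta>)))
    \<le> ennreal (1 - \<delta>) * (\<integral>\<^sup>+y\<in>?B. (\<integral>\<^sup>+x\<in>?B.
       ennreal (\<bar>indicator E x - indicator E y\<bar> / dist x y powr ?q) \<partial>lborel) \<partial>lborel)"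
    by (rule mult_left_mono) simp
  moreover have "0 \<le> \<beta>"
    by (simp add: \<beta>_def)
  moreover have "(1 - \<delta>) * (\<beta> * r powr (?n - 1) * (r powr (1 - \<delta>) / (1 - \<delta>))) = \<beta> * r powr (?n - \<delta>)"
    using \<delta> r by (simp add: powr_add[symmetric])
  ultimately show ?thesis
    using \<delta> by (simp only: ennreal_mult[symmetric] divide_nonneg_nonneg mult_nonneg_nonneg powr_ge_zero diff_ge_0_iff_ge less_imp_le)
qed

section \<open>Balls of density one half along John curves\<close>

lemma AE_lborel_not_in_sphere:
  fixes c :: "'a::euclidean_space"
  shows "AE x in lborel. dist c x \<noteq> r"
proof -
  have "sphere c r \<in> null_sets lborel"
    using negligible_sphere[of c r] by (simp add: negligible_iff_null_sets null_sets_completion_iff)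
  from AE_not_in[OF this] show ?thesis
    by eventually_elim auto
qed

text \<open>Dominated convergence: off the limiting sphere, a null set, membership in the moving
  ball is eventually constant. Center and radius vary together because the intermediate value
  theorem is applied both in the radius at a fixed center and along a curve with a radius tied to
  the boundary distance.\<close>

lemma continuous_on_measure_Int_ball:
  fixes E :: "'a::euclidean_space set" and p :: "'b::metric_space \<Rightarrow> 'a"
  assumes [measurable]: "E \<in> sets borel" and p: "continuous_on S p" and q: "continuous_on S q"
  shows "continuous_on S (\<lambda>t. measure lborel (E \<inter> ball (p t) (q t)))"
proof (rule continuous_on_sequentiallyI)
  fix u a assume u: "\<forall>n. u n \<in> S" "a \<in> S" "u \<longlonglongrightarrow> a"
  have pu: "(\<lambda>n. p (u n)) \<longlonglongrightarrow> p a" and qu: "(\<lambda>n. q (u n)) \<longlonglongrightarrow> q a"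
    using continuous_on_tendsto_compose[OF p u(3,2)] continuous_on_tendsto_compose[OF q u(3,2)] u(1) by auto
  have "(\<lambda>n. dist (p a) (p (u n)) + q (u n)) \<longlonglongrightarrow> dist (p a) (p a) + q a"
    by (intro tendsto_intros pu qu)
  \<comment> \<open>Any bound \<open>K\<close> of this sequence is the radius of one closed ball
    about \<open>p a\<close> that contains all moving balls, which gives the dominating
    function.\<close>
  then have "Bseq (\<lambda>n. dist (p a) (p (u n)) + q (u n))"
    by (intro convergent_imp_Bseq convergentI)
  then obtain K where K: "\<And>n. dist (p a) (p (u n)) + q (u n) \<le> K"
    by (auto simp: Bseq_def abs_le_iff)
  have "(\<lambda>n. \<integral>x. indicator (E \<inter> ball (p (u n)) (q (u n))) x \<partial>lborel)
    \<longlonglongrightarrow> (\<integral>x. (indicator (E \<inter> ball (p a) (q a)) x :: real) \<partial>lborel)"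
  proof (rule integral_dominated_convergence)
    show "integrable lborel (indicator (cball (p a) K) :: 'a \<Rightarrow> real)"
      using emeasure_bounded_finite[OF bounded_cball[of "p a" K]] by (simp add: less_top)
    show "AE x in lborel. (\<lambda>n. indicator (E \<inter> ball (p (u n)) (q (u n))) x :: real)
       \<longlonglongrightarrow> indicator (E \<inter> ball (p a) (q a)) x"
      using AE_lborel_not_in_sphere[of "p a" "q a"]
    proof eventually_elim
      case (elim x)
      have lim: "(\<lambda>n. dist (p (u n)) x - q (u n)) \<longlonglongrightarrow> dist (p a) x - q a"
        by (intro tendsto_intros pu qu)
      have "\<forall>\<^sub>F n in sequentially. (dist (p (u n)) x < q (u n)) = (dist (p a) x < q a)"
      proof (cases "dist (p a) x < q a")
        case True
        then show ?thesis
          using order_tendstoD(2)[OF lim, of 0] by (auto elim!: eventually_mono)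
      next
        case False
        then show ?thesis
          using order_tendstoD(1)[OF lim, of 0] elim by (auto elim!: eventually_mono)
      qed
      then show ?case
        by (intro tendsto_eventually) (auto elim!: eventually_mono simp: indicator_def)
    qed
    show "AE x in lborel. norm (indicator (E \<inter> ball (p (u n)) (q (u n))) x :: real) \<le> indicator (cball (p a) K) x" for n
    proof (intro AE_I2)
      fix x
      have "dist (p a) x \<le> dist (p a) (p (u n)) + dist (p (u n)) x"
        by (rule dist_triangle)
      then show "norm (indicator (E \<inter> ball (p (u n)) (q (u n))) x :: real) \<le> indicator (cball (p a) K) x"
        using K[of n] by (auto simp: indicator_def)
    qed
  qed (use assms(1) in \<open>auto intro!: borel_measurable_indicator\<close>)
  then show "(\<lambda>n. measure lborel (E \<inter> ball (p (u n)) (q (u n)))) \<longlonglongrightarrow> measure lborel (E \<inter> ball (p a) (q a))"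
    by simp
qed

lemma continuous_on_ball_excess:
  fixes E :: "'a::euclidean_space set" and p :: "'b::metric_space \<Rightarrow> 'a"
  assumes "E \<in> sets borel" and "continuous_on S p" and "continuous_on S q"
  shows "continuous_on S (\<lambda>t. measure lborel (E \<inter> ball (p t) (q t)) - measure lborel (ball (p t) (q t)) / 2)"
  using continuous_on_measure_Int_ball[OF assms] continuous_on_measure_Int_ball[OF _ assms(2,3), of UNIV]
  by (intro continuous_intros) auto

text \<open>A ball that contains \<open>c\<close> and leaves \<open>\<Omega>\<close> is connected,
  so it meets the frontier, at a distance from \<open>c\<close> below the infimum.\<close>

lemma ball_bdist_subset:
  fixes \<Omega> :: "'a::euclidean_space set"
  assumes "c \<in> \<Omega>"
  shows "ball c (bdist \<Omega> c) \<subseteq> \<Omega>"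
proof (rule ccontr)
  assume *: "\<not> ball c (bdist \<Omega> c) \<subseteq> \<Omega>"
  then have "c \<in> ball c (bdist \<Omega> c)"
    using le_less_trans[OF zero_le_dist] by fastforce
  then have "ball c (bdist \<Omega> c) \<inter> frontier \<Omega> \<noteq> {}"
    using * assms by (intro connected_Int_frontier) (blast intro: connected_ball)+
  then obtain z where "z \<in> frontier \<Omega>" "dist c z < bdist \<Omega> c"
    by auto
  then show False
    using infdist_le[of z "frontier \<Omega>" c] by (simp add: bdist_def)
qed

text \<open>At the start of the curve the John inequality reads
  \<open>C * bdist \<Omega> x > 0\<close>, since \<open>0 powr s = 0\<close>.\<close>

lemma john_bdist_pos:
  assumes "john_domain_with_center s C x\<^sub>J \<Omega>" "x \<in> \<Omega>"
  shows "0 < bdist \<Omega> x"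
proof -
  obtain \<gamma> where "pathstart \<gamma> = x" "C * bdist \<Omega> (\<gamma> 0) > dist (\<gamma> 0) x powr s" "1 \<le> C"
    using assms unfolding john_domain_with_center_def by force
  then show ?thesis
    by (simp add: pathstart_def zero_less_mult_iff)
qed

lemma bdist_le_diameter:
  assumes "john_domain_with_center s C x\<^sub>J \<Omega>" "x \<in> \<Omega>"
  shows "2 * bdist \<Omega> x \<le> diameter \<Omega>"
  using diameter_subset[OF ball_bdist_subset[OF assms(2)]] john_bdist_pos[OF assms] assms(1)
  by (simp add: john_domain_with_center_def)

lemma john_diameter_pos:
  assumes "john_domain_with_center s C x\<^sub>J \<Omega>"
  shows "0 < diameter \<Omega>"
  using bdist_le_diameter[OF assms, of x\<^sub>J] john_bdist_pos[OF assms, of x\<^sub>J] assms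
  by (simp add: john_domain_with_center_def)

text \<open>The John inequality is read at the end of a curve that starts at distance at least a
  quarter of the diameter from the center; without such a point \<open>\<Omega>\<close> would lie in
  a ball of half its diameter. This later bounds the volume of \<open>\<Omega>\<close> from below by
  the allowed data alone.\<close>

lemma john_bdist_center_ge:
  assumes J: "john_domain_with_center s C x\<^sub>J \<Omega>"
  shows "(diameter \<Omega> / 4) powr s \<le> C * bdist \<Omega> x\<^sub>J"
proof -
  have D: "0 < diameter \<Omega>" by (rule john_diameter_pos[OF J])
  have "\<exists>x\<in>\<Omega>. diameter \<Omega> / 4 \<le> dist x\<^sub>J x"
  proof (rule ccontr)
    assume "\<not> ?thesis"
    then have "\<Omega> \<subseteq> ball x\<^sub>J (diameter \<Omega> / 4)"
      by (auto simp: not_le)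
    from diameter_subset[OF this] D show False
      by simp
  qed
  then obtain x where x: "x \<in> \<Omega>" "diameter \<Omega> / 4 \<le> dist x\<^sub>J x" by blast
  then obtain \<gamma> where "pathfinish \<gamma> = x\<^sub>J" "C * bdist \<Omega> (\<gamma> 1) > dist (\<gamma> 1) x powr s" "1 \<le> s"
    using J unfolding john_domain_with_center_def by force
  moreover have "(diameter \<Omega> / 4) powr s \<le> dist x\<^sub>J x powr s"
    using x D \<open>1 \<le> s\<close> by (intro powr_mono2) auto
  ultimately show ?thesis
    by (simp add: pathfinish_def)
qed

text \<open>Two applications of the intermediate value theorem to the excess density
  \<open>\<phi>\<close>: in the radius at \<open>x\<close>, or else along the John curve with the
  radius kept at \<open>\<kappa>\<close> times the boundary distance.\<close>

lemma john_half_density_ball: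
  assumes J: "john_domain_with_center s C x\<^sub>J \<Omega>" and E: "E \<in> sets borel" and \<kappa>: "0 < \<kappa>" and x: "x \<in> \<Omega>"
    and dense: "0 < r\<^sub>0" "r\<^sub>0 \<le> \<kappa> * bdist \<Omega> x"
      "measure lborel (ball x r\<^sub>0) / 2 < measure lborel (E \<inter> ball x r\<^sub>0)"
    and sparse: "measure lborel (E \<inter> ball x\<^sub>J (\<kappa> * bdist \<Omega> x\<^sub>J)) \<le> measure lborel (ball x\<^sub>J (\<kappa> * bdist \<Omega> x\<^sub>J)) / 2"
  obtains c r where "c \<in> \<Omega>" "0 < r" "r \<le> \<kappa> * bdist \<Omega> c" "dist c x < (C * r / \<kappa>) powr (1 / s)"
    "measure lborel (E \<inter> ball c r) = measure lborel (ball c r) / 2"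
proof -
  define \<phi> where "\<phi> c r = measure lborel (E \<inter> ball c r) - measure lborel (ball c r) / 2" for c r
  have sC: "1 \<le> s" "1 \<le> C"
    using J by (auto simp: john_domain_with_center_def)
  show thesis
  proof (cases "\<phi> x (\<kappa> * bdist \<Omega> x) \<le> 0")
    \<comment> \<open>The largest admissible ball at \<open>x\<close> is already sparse, so
      \<open>\<phi>\<close> vanishes at some radius above \<open>r\<^sub>0\<close>; the center is
      \<open>x\<close> itself and the distance condition is trivial.\<close>
    case True
    have "continuous_on {r\<^sub>0..\<kappa> * bdist \<Omega> x} (\<phi> x)"
      unfolding \<phi>_def by (rule continuous_on_ball_excess[OF E]) (intro continuous_intros)+
    then obtain r where r: "r\<^sub>0 \<le> r" "r \<le> \<kappa> * bdist \<Omega> x" "\<phi> x r = 0"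
      using IVT2'[of "\<phi> x" "\<kappa> * bdist \<Omega> x" 0 r\<^sub>0] True dense by (auto simp: \<phi>_def)
    have "0 < r" using r dense by linarith
    then show thesis
      using r x sC \<kappa> by (intro that[of x r]) (auto simp: \<phi>_def)
  next
    \<comment> \<open>Here the largest ball at \<open>x\<close> is dense while the one at
      \<open>x\<^sub>J\<close> is sparse, so \<open>\<phi>\<close> vanishes at some time of the
      curve.\<close>
    case False
    obtain \<gamma> where \<gamma>: "rectifiable \<gamma>" "path_image \<gamma> \<subseteq> \<Omega>" "pathstart \<gamma> = x" "pathfinish \<gamma> = x\<^sub>J"
       "\<And>t. t \<in> {0..1} \<Longrightarrow> C * bdist \<Omega> (\<gamma> t) > dist (\<gamma> t) x powr s"
      using J x unfolding john_domain_with_center_def by blast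
    have c\<gamma>: "continuous_on {0..1} \<gamma>"
      using \<gamma>(1) by (simp add: rectifiable_def path_def)
    have "continuous_on {0..1} (\<lambda>t. \<phi> (\<gamma> t) (\<kappa> * bdist \<Omega> (\<gamma> t)))"
      unfolding \<phi>_def bdist_def by (rule continuous_on_ball_excess[OF E]) (intro continuous_intros c\<gamma>)+
    then obtain t where t: "0 \<le> t" "t \<le> 1" "\<phi> (\<gamma> t) (\<kappa> * bdist \<Omega> (\<gamma> t)) = 0"
      using IVT2'[of "\<lambda>t. \<phi> (\<gamma> t) (\<kappa> * bdist \<Omega> (\<gamma> t))" 1 0 0] False sparse \<gamma>(3,4)
      by (auto simp: \<phi>_def pathstart_def pathfinish_def)
    let ?r = "\<kappa> * bdist \<Omega> (\<gamma> t)"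
    have in\<Omega>: "\<gamma> t \<in> \<Omega>"
      using \<gamma>(2) t by (auto simp: path_image_def)
    have r: "0 < ?r"
      using john_bdist_pos[OF J in\<Omega>] \<kappa> by simp
    \<comment> \<open>The radius is \<open>\<kappa>\<close> times the boundary distance, so the John
      inequality bounds the \<open>s\<close>-th power of the distance by
      \<open>C * ?r / \<kappa>\<close>.\<close>
    have "dist (\<gamma> t) x = (dist (\<gamma> t) x powr s) powr (1 / s)"
      using sC by (simp add: powr_powr)
    also have "\<dots> < (C * ?r / \<kappa>) powr (1 / s)"
      using \<gamma>(5)[of t] t \<kappa> sC by (intro powr_less_mono2) auto
    finally show thesis
      using in\<Omega> r t by (intro that[of "\<gamma> t" ?r]) (auto simp: \<phi>_def)
  qed
qed

section \<open>Vitali covering and Hausdorff content\<close>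

text \<open>For an indicator function this is a nonlocal perimeter of the set, restricted to pairs
  that are close relative to the boundary distance of \<open>y\<close>.\<close>

definition frac_energy :: "real \<Rightarrow> real \<Rightarrow> 'a::euclidean_space set \<Rightarrow> ('a \<Rightarrow> real) \<Rightarrow> ennreal" where
  "frac_energy \<tau> \<delta> \<Omega> f = (\<integral>\<^sup>+y\<in>\<Omega>. (\<integral>\<^sup>+x\<in>{x\<in>\<Omega>. dist x y < \<tau> * bdist \<Omega> y}.
     ennreal (\<bar>f x - f y\<bar> / dist x y powr (real DIM('a) + \<delta>)) \<partial>lebesgue) \<partial>lebesgue)"

lemma hausdorff_content_le_countable_cover:
  assumes I: "countable I" and cov: "A \<subseteq> (\<Union>i\<in>I. ball (c i) (r i))" and r: "\<And>i. i \<in> I \<Longrightarrow> 0 \<le> r i"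
  shows "hausdorff_content \<alpha> A \<le> (\<integral>\<^sup>+i. ennreal (unit_ball_vol \<alpha> * r i powr \<alpha>) \<partial>count_space I)"
proof -
  let ?f = "to_nat_on I" and ?g = "inv_into I (to_nat_on I)"
  let ?N = "?f ` I"
  \<comment> \<open>Naturals that are not the code of an index get radius 0: the ball is empty and
    \<open>0 powr \<alpha> = 0\<close>, so finite and infinite \<open>I\<close> are treated
    alike.\<close>
  define r' where "r' n = (if n \<in> ?N then r (?g n) else 0)" for n
  have bij: "bij_betw ?g ?N I"
    using I by (simp add: bij_betw_inv_into inj_on_imp_bij_betw inj_on_to_nat_on)
  have "A \<subseteq> (\<Union>n. ball (c (?g n)) (r' n))"
  proof
    fix x assume "x \<in> A"
    then obtain i where i: "i \<in> I" "x \<in> ball (c i) (r i)"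
      using cov by auto
    have "?g (?f i) = i"
      using I i(1) by (intro inv_into_f_f inj_on_to_nat_on)
    with i have "x \<in> ball (c (?g (?f i))) (r' (?f i))"
      unfolding r'_def by simp
    then show "x \<in> (\<Union>n. ball (c (?g n)) (r' n))"
      by blast
  qed
  moreover have "0 \<le> r' n" for n
    using r[OF inv_into_into[of n "?f" I]] unfolding r'_def by simp
  ultimately have "hausdorff_content \<alpha> A \<le> (\<Sum>n. ennreal (unit_ball_vol \<alpha> * r' n powr \<alpha>))"
    unfolding hausdorff_content_def by (intro Inf_lower CollectI exI conjI refl) auto
  also have "\<dots> = (\<integral>\<^sup>+n. ennreal (unit_ball_vol \<alpha> * r (?g n) powr \<alpha>) * indicator ?N n \<partial>count_space UNIV)"
    unfolding nn_integral_count_space_nat[symmetric]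
    by (intro nn_integral_cong) (auto simp: r'_def)
  also have "\<dots> = (\<integral>\<^sup>+n. ennreal (unit_ball_vol \<alpha> * r (?g n) powr \<alpha>) \<partial>count_space ?N)"
    by (simp add: nn_integral_count_space_indicator)
  also have "\<dots> = (\<integral>\<^sup>+i. ennreal (unit_ball_vol \<alpha> * r i powr \<alpha>) \<partial>count_space I)"
    by (rule nn_integral_bij_count_space[OF bij])
  finally show ?thesis .
qed

text \<open>This is where the 4 in \<open>\<tau> / 4\<close> is spent. For \<open>y\<close> in the
  ball the boundary distance exceeds half of that of the center, so two points of the ball are at
  distance below \<open>2 * r i\<close>, which is less than
  \<open>\<tau> * bdist \<Omega> y\<close>.\<close>

lemma sum_disjoint_balls_energy_le:
  fixes c :: "'i \<Rightarrow> 'a::euclidean_space" and E \<Omega> :: "'a set"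
  assumes I: "countable I" and dj: "pairwise (\<lambda>i j. disjnt (ball (c i) (r i)) (ball (c j) (r j))) I"
    and [measurable]: "E \<in> sets borel" and \<tau>: "0 < \<tau>" "\<tau> < 1"
    and c: "\<And>i. i \<in> I \<Longrightarrow> c i \<in> \<Omega>" and r: "\<And>i. i \<in> I \<Longrightarrow> r i \<le> \<tau> / 4 * bdist \<Omega> (c i)"
  shows "(\<integral>\<^sup>+i. (\<integral>\<^sup>+y\<in>ball (c i) (r i). (\<integral>\<^sup>+x\<in>ball (c i) (r i).
       ennreal (\<bar>indicator E x - indicator E y\<bar> / dist x y powr (real DIM('a) + \<delta>)) \<partial>lborel) \<partial>lborel)
     \<partial>count_space I) \<le> frac_energy \<tau> \<delta> \<Omega> (indicator E)"
proof -
  let ?B = "\<lambda>i. ball (c i) (r i)"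
  define K where "K x y = ennreal (\<bar>indicator E x - indicator E y\<bar> / dist x y powr (real DIM('a) + \<delta>))" for x y
  define G where "G y = (\<integral>\<^sup>+x\<in>{x\<in>\<Omega>. dist x y < \<tau> * bdist \<Omega> y}. K x y \<partial>lborel)" for y
  have [measurable]: "(\<lambda>(x, y). K x y) \<in> borel_measurable (borel \<Otimes>\<^sub>M borel)"
    unfolding K_def by measurable
  have [measurable]: "ball (c i) (r i) \<in> sets borel" for i
    by simp
  have "(\<integral>\<^sup>+x\<in>?B i. K x y \<partial>lborel) \<le> G y \<and> y \<in> \<Omega>" if i: "i \<in> I" "y \<in> ?B i" for i y
  proof -
    have b: "0 < bdist \<Omega> (c i)"
    proof -
      have "0 < r i"
        using i(2) le_less_trans[OF zero_le_dist, of "c i" y "r i"] by simp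
      then have "0 < \<tau> / 4 * bdist \<Omega> (c i)"
        using r[OF i(1)] by (rule order.strict_trans2)
      then show ?thesis
        using \<tau> by (simp add: zero_less_mult_iff)
    qed
    have "r i \<le> bdist \<Omega> (c i)"
      using r[OF i(1)] \<tau> b mult_right_mono[of "\<tau> / 4" 1 "bdist \<Omega> (c i)"] by linarith
    then have sub: "?B i \<subseteq> \<Omega>"
      using ball_bdist_subset[OF c[OF i(1)]] by (meson order.trans subset_ball)
    have "bdist \<Omega> (c i) \<le> bdist \<Omega> y + dist (c i) y"
      unfolding bdist_def by (rule infdist_triangle)
    moreover have "\<tau> * bdist \<Omega> (c i) < 1 * bdist \<Omega> (c i)"
      using b \<tau> by (intro mult_strict_right_mono) auto
    ultimately have "bdist \<Omega> (c i) / 2 < bdist \<Omega> y"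
      using i(2) r[OF i(1)] b by (simp only: mem_ball)
    then have "\<tau> * (bdist \<Omega> (c i) / 2) < \<tau> * bdist \<Omega> y"
      using \<tau> by (intro mult_strict_left_mono) auto
    then have "2 * r i < \<tau> * bdist \<Omega> y"
      using r[OF i(1)] by (simp add: field_simps)
    then have "dist x y < \<tau> * bdist \<Omega> y" if "x \<in> ?B i" for x
      using that i dist_triangle_less_add[of x "c i" "r i" y "r i"] by (auto simp: dist_commute)
    then have "?B i \<subseteq> {x\<in>\<Omega>. dist x y < \<tau> * bdist \<Omega> y}"
      using sub by auto
    then have "(\<integral>\<^sup>+x\<in>?B i. K x y \<partial>lborel) \<le> G y"
      unfolding G_def by (intro nn_integral_mono mult_left_mono) (auto simp: indicator_def)
    then show ?thesis
      using sub i by auto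
  qed
  then have le: "(\<integral>\<^sup>+x\<in>?B i. K x y \<partial>lborel) \<le> G y" "y \<in> \<Omega>" if "i \<in> I" "y \<in> ?B i" for i y
    using that by blast+
  \<comment> \<open>By disjointness at most one index contributes at a given \<open>y\<close>, so
    the sum costs no multiplicity.\<close>
  have pt: "(\<integral>\<^sup>+i. (\<integral>\<^sup>+x\<in>?B i. K x y \<partial>lborel) * indicator (?B i) y \<partial>count_space I) \<le> G y * indicator \<Omega> y" for y
  proof (cases "\<exists>i\<in>I. y \<in> ?B i")
    case True
    then obtain i where i: "i \<in> I" "y \<in> ?B i" by blast
    have "y \<notin> ?B j" if "j \<in> I" "j \<noteq> i" for j
      using dj that i unfolding pairwise_def disjnt_def by blast
    then have "(\<integral>\<^sup>+i. (\<integral>\<^sup>+x\<in>?B i. K x y \<partial>lborel) * indicator (?B i) y \<partial>count_space I)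
       \<le> (\<integral>\<^sup>+j. G y * indicator {i} j \<partial>count_space I)"
      using le(1)[OF i] by (intro nn_integral_mono) (auto simp: indicator_def)
    also have "\<dots> = G y"
      using i by (subst nn_integral_cmult_indicator) auto
    finally show ?thesis
      using le(2)[OF i] by simp
  next
    case False
    then have "(\<integral>\<^sup>+i. (\<integral>\<^sup>+x\<in>?B i. K x y \<partial>lborel) * indicator (?B i) y \<partial>count_space I) = (\<integral>\<^sup>+i. 0 \<partial>count_space I)"
      by (intro nn_integral_cong) auto
    then show ?thesis by simp
  qed
  have "(\<integral>\<^sup>+i. (\<integral>\<^sup>+y\<in>?B i. (\<integral>\<^sup>+x\<in>?B i. K x y \<partial>lborel) \<partial>lborel) \<partial>count_space I)
    = (\<integral>\<^sup>+y. (\<integral>\<^sup>+i. (\<integral>\<^sup>+x\<in>?B i. K x y \<partial>lborel) * indicator (?B i) y \<partial>count_space I) \<partial>lborel)"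
    by (rule nn_integral_count_space_nn_integral[symmetric, OF I]) measurable
  also have "\<dots> \<le> (\<integral>\<^sup>+y\<in>\<Omega>. G y \<partial>lborel)"
    by (intro nn_integral_mono pt)
  also have "\<dots> = frac_energy \<tau> \<delta> \<Omega> (indicator E)"
    unfolding frac_energy_def G_def K_def by (simp add: nn_integral_completion)
  finally show ?thesis
    unfolding K_def .
qed

text \<open>Multiplied by \<open>r powr (1 / s)\<close>, the first summand bounds the distance from
  the starting point to the center \<open>c\<close>, and the second bounds \<open>r\<close> itself
  as long as \<open>r \<le> D\<close>.\<close>

definition cover_factor :: "real \<Rightarrow> real \<Rightarrow> real \<Rightarrow> real \<Rightarrow> real" where
  "cover_factor s C \<kappa> D = (C / \<kappa>) powr (1 / s) + D powr (1 - 1 / s)"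

text \<open>Vitali is applied to enlarged balls of radius a constant times
  \<open>r powr (1 / s)\<close>, which contain both the point to be covered and the half-density
  ball. The selection must be disjoint for the energy estimate and its dilates must cover for the
  content; the enlarged balls serve both purposes.\<close>

lemma boxing_cover:
  fixes E \<Omega> A :: "'a::euclidean_space set"
  defines "\<beta> \<equiv> (unit_ball_vol (real DIM('a)) / 2) ^ 2 / 3 ^ (DIM('a) + 1)"
  assumes J: "john_domain_with_center s C x\<^sub>J \<Omega>" and E: "E \<in> sets borel"
    and \<tau>: "0 < \<tau>" "\<tau> < 1" and \<delta>: "0 < \<delta>" "\<delta> < 1"
    and sparse: "measure lborel (E \<inter> ball x\<^sub>J (\<tau> / 4 * bdist \<Omega> x\<^sub>J)) \<le> measure lborel (ball x\<^sub>J (\<tau> / 4 * bdist \<Omega> x\<^sub>J)) / 2"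
    and A: "A \<subseteq> {x\<in>\<Omega>. \<exists>r. 0 < r \<and> r \<le> \<tau> / 4 * bdist \<Omega> x \<and>
         measure lborel (ball x r) / 2 < measure lborel (E \<inter> ball x r)}"
  obtains I :: "'a set" and c :: "'a \<Rightarrow> 'a" and r where "countable I"
    "\<And>i. i \<in> I \<Longrightarrow> 0 < r i \<and> r i \<le> diameter \<Omega>"
    "A \<subseteq> (\<Union>i\<in>I. ball (c i) (5 * (cover_factor s C (\<tau> / 4) (diameter \<Omega>) * r i powr (1 / s))))"
    "(\<integral>\<^sup>+i. ennreal (\<beta> * r i powr (real DIM('a) - \<delta>)) \<partial>count_space I) \<le> ennreal (1 - \<delta>) * frac_energy \<tau> \<delta> \<Omega> (indicator E)"
proof -
  let ?\<kappa> = "\<tau> / 4" and ?D = "diameter \<Omega>"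
  define M where "M = cover_factor s C ?\<kappa> ?D"
  have sC: "1 \<le> s" "1 \<le> C"
    using J by (auto simp: john_domain_with_center_def)
  have D: "0 < ?D" by (rule john_diameter_pos[OF J])
  have "\<forall>x\<in>A. \<exists>c r. c \<in> \<Omega> \<and> 0 < r \<and> r \<le> ?\<kappa> * bdist \<Omega> c \<and> dist c x < (C * r / ?\<kappa>) powr (1 / s)
    \<and> measure lborel (E \<inter> ball c r) = measure lborel (ball c r) / 2"
  proof
    fix x assume "x \<in> A"
    then obtain r\<^sub>0 where "x \<in> \<Omega>" "0 < r\<^sub>0" "r\<^sub>0 \<le> ?\<kappa> * bdist \<Omega> x"
      "measure lborel (ball x r\<^sub>0) / 2 < measure lborel (E \<inter> ball x r\<^sub>0)"
      using A by blast
    from john_half_density_ball[OF J E _ this sparse] \<tau>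
    show "\<exists>c r. c \<in> \<Omega> \<and> 0 < r \<and> r \<le> ?\<kappa> * bdist \<Omega> c \<and> dist c x < (C * r / ?\<kappa>) powr (1 / s)
      \<and> measure lborel (E \<inter> ball c r) = measure lborel (ball c r) / 2"
      by (metis zero_less_divide_iff zero_less_numeral)
  qed
  then obtain c r where cr: "\<And>x. x \<in> A \<Longrightarrow> c x \<in> \<Omega>" "\<And>x. x \<in> A \<Longrightarrow> 0 < r x"
    "\<And>x. x \<in> A \<Longrightarrow> r x \<le> ?\<kappa> * bdist \<Omega> (c x)" "\<And>x. x \<in> A \<Longrightarrow> dist (c x) x < (C * r x / ?\<kappa>) powr (1 / s)"
    "\<And>x. x \<in> A \<Longrightarrow> measure lborel (E \<inter> ball (c x) (r x)) = measure lborel (ball (c x) (r x)) / 2"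
    by metis
  have rD: "r x \<le> ?D" if "x \<in> A" for x
  proof -
    have "?\<kappa> * bdist \<Omega> (c x) \<le> 1 * bdist \<Omega> (c x)"
      using \<tau> john_bdist_pos[OF J cr(1)[OF that]] by (intro mult_right_mono) auto
    then show ?thesis
      using cr(3)[OF that] bdist_le_diameter[OF J cr(1)[OF that]] D john_bdist_pos[OF J cr(1)[OF that]] by linarith
  qed
  have rM: "r x \<le> M * r x powr (1 / s)" and xM: "x \<in> ball (c x) (M * r x powr (1 / s))"
    and MB: "M * r x powr (1 / s) \<le> M * ?D powr (1 / s)" if "x \<in> A" for x
  proof -
    have rx: "0 < r x" by (rule cr(2)[OF that])
    have "r x = r x powr (1 - 1 / s) * r x powr (1 / s)"
      using rx by (simp add: powr_add[symmetric])
    also have "\<dots> \<le> ?D powr (1 - 1 / s) * r x powr (1 / s)"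
      using rx sC rD[OF that] by (intro mult_right_mono powr_mono2) auto
    also have "\<dots> \<le> M * r x powr (1 / s)"
      by (intro mult_right_mono) (auto simp: M_def cover_factor_def)
    finally show "r x \<le> M * r x powr (1 / s)" .
    have "(C * r x / ?\<kappa>) powr (1 / s) = (C / ?\<kappa>) powr (1 / s) * r x powr (1 / s)"
      using powr_mult[of "C / ?\<kappa>" "r x" "1 / s"] rx sC \<tau> by (simp only: times_divide_eq_left)
    also have "\<dots> \<le> M * r x powr (1 / s)"
      by (intro mult_right_mono) (auto simp: M_def cover_factor_def)
    finally show "x \<in> ball (c x) (M * r x powr (1 / s))"
      using cr(4)[OF that] by simp
    show "M * r x powr (1 / s) \<le> M * ?D powr (1 / s)"
      using rx rD[OF that] sC by (intro mult_left_mono powr_mono2) (auto simp: M_def cover_factor_def)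
  qed
  have bnd: "0 < M * r x powr (1 / s) \<and> M * r x powr (1 / s) \<le> M * ?D powr (1 / s)" if "x \<in> A" for x
    using rM[OF that] cr(2)[OF that] MB[OF that] by linarith
  have cov: "A \<subseteq> (\<Union>x\<in>A. ball (c x) (M * r x powr (1 / s)))"
    using xM by blast
  obtain I where I: "countable I" "I \<subseteq> A"
    "pairwise (\<lambda>i j. disjnt (ball (c i) (M * r i powr (1 / s))) (ball (c j) (M * r j powr (1 / s)))) I"
    "A \<subseteq> (\<Union>i\<in>I. ball (c i) (5 * (M * r i powr (1 / s))))"
    using Vitali_covering_lemma_balls[OF cov bnd] by blast
  \<comment> \<open>Disjointness passes from the enlarged balls to the concentric half-density
    balls, because \<open>rM\<close> makes the latter smaller.\<close>
  have dj: "pairwise (\<lambda>i j. disjnt (ball (c i) (r i)) (ball (c j) (r j))) I"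
  proof (rule pairwiseI)
    fix i j assume ij: "i \<in> I" "j \<in> I" "i \<noteq> j"
    then have "disjnt (ball (c i) (M * r i powr (1 / s))) (ball (c j) (M * r j powr (1 / s)))"
      using I(3) by (simp add: pairwise_def)
    then show "disjnt (ball (c i) (r i)) (ball (c j) (r j))"
      using ij I(2) rM by (meson disjnt_subset1 disjnt_subset2 subset_ball subsetD)
  qed
  have "(\<integral>\<^sup>+i. ennreal (\<beta> * r i powr (real DIM('a) - \<delta>)) \<partial>count_space I) \<le>
    (\<integral>\<^sup>+i. ennreal (1 - \<delta>) * (\<integral>\<^sup>+y\<in>ball (c i) (r i). (\<integral>\<^sup>+x\<in>ball (c i) (r i).
       ennreal (\<bar>indicator E x - indicator E y\<bar> / dist x y powr (real DIM('a) + \<delta>)) \<partial>lborel) \<partial>lborel)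
     \<partial>count_space I)"
    unfolding \<beta>_def using I(2) by (intro nn_integral_mono half_density_ball_energy E \<delta> cr) auto
  also have "\<dots> = ennreal (1 - \<delta>) * (\<integral>\<^sup>+i. (\<integral>\<^sup>+y\<in>ball (c i) (r i). (\<integral>\<^sup>+x\<in>ball (c i) (r i).
       ennreal (\<bar>indicator E x - indicator E y\<bar> / dist x y powr (real DIM('a) + \<delta>)) \<partial>lborel) \<partial>lborel)
     \<partial>count_space I)"
    by (rule nn_integral_cmult) simp
  also have "\<dots> \<le> ennreal (1 - \<delta>) * frac_energy \<tau> \<delta> \<Omega> (indicator E)"
    using I(2) cr by (intro mult_left_mono sum_disjoint_balls_energy_le I(1) dj E \<tau>) auto
  finally show thesis
    using I cr rD by (intro that[of I r c]) (auto simp: M_def)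
qed

text \<open>The exponent of the content varies with \<open>\<delta>\<close>, so its normalizing
  factor needs a bound uniform over a compact interval; continuity of the Gamma function supplies
  one.\<close>

lemma unit_ball_vol_bounded:
  obtains U where "0 < U" "\<And>\<alpha>. 0 \<le> \<alpha> \<Longrightarrow> \<alpha> \<le> b \<Longrightarrow> unit_ball_vol \<alpha> \<le> U"
proof -
  have "continuous_on {0<..} (Gamma :: real \<Rightarrow> real)"
    by (intro continuous_on_Gamma) (auto elim!: nonpos_Ints_cases)
  then have "continuous_on {0..b} (\<lambda>x. Gamma (x / 2 + 1))"
    by (rule continuous_on_compose2) (auto intro!: continuous_intros)
  then have "continuous_on {0..b} unit_ball_vol"
    unfolding unit_ball_vol_def
    by (intro continuous_intros) (auto simp: Gamma_eq_zero_iff elim!: nonpos_Ints_cases)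
  then have "bounded (unit_ball_vol ` {0..b})"
    by (intro compact_imp_bounded compact_continuous_image) auto
  then obtain U where "0 < U" "\<And>y. y \<in> unit_ball_vol ` {0..b} \<Longrightarrow> norm y \<le> U"
    unfolding bounded_pos by blast
  then show thesis
    by (intro that[of U]) force+
qed

lemma hausdorff_content_mono: "A \<subseteq> B \<Longrightarrow> hausdorff_content \<alpha> A \<le> hausdorff_content \<alpha> B"
  unfolding hausdorff_content_def by (rule Inf_superset_mono) blast

lemma hausdorff_content_Un:
  fixes A B :: "'a::euclidean_space set"
  shows "hausdorff_content \<alpha> (A \<union> B) \<le> hausdorff_content \<alpha> A + hausdorff_content \<alpha> B"
proof (rule ennreal_le_epsilon)
  fix e :: real
  assume "0 < e" and fin: "hausdorff_content \<alpha> A + hausdorff_content \<alpha> B < top"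
  have cover: "\<exists>c r. (\<forall>i. 0 \<le> r i) \<and> S \<subseteq> (\<Union>i. ball (c i) (r i)) \<and>
     (\<Sum>i. ennreal (unit_ball_vol \<alpha> * r i powr \<alpha>)) \<le> hausdorff_content \<alpha> S + ennreal (e / 2)"
    if "hausdorff_content \<alpha> S < top" for S :: "'a set"
  proof -
    have "hausdorff_content \<alpha> S < hausdorff_content \<alpha> S + ennreal (e / 2)"
      using that \<open>0 < e\<close> by (cases "hausdorff_content \<alpha> S") (auto simp: ennreal_less_iff simp flip: ennreal_plus)
    then obtain z c r where "z < hausdorff_content \<alpha> S + ennreal (e / 2)"
      "z = (\<Sum>i. ennreal (unit_ball_vol \<alpha> * r i powr \<alpha>))" "\<forall>i :: nat. 0 \<le> r i" "S \<subseteq> (\<Union>i. ball (c i) (r i))"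
      by (subst (asm) (1) hausdorff_content_def) (auto simp only: Inf_less_iff mem_Collect_eq)
    then show ?thesis
      by (intro exI[of _ c] exI[of _ r]) auto
  qed
  obtain c r where A: "\<forall>i. 0 \<le> r i" "A \<subseteq> (\<Union>i. ball (c i) (r i))"
     "(\<Sum>i. ennreal (unit_ball_vol \<alpha> * r i powr \<alpha>)) \<le> hausdorff_content \<alpha> A + ennreal (e / 2)"
    using cover[of A] fin by auto
  obtain c' r' where B: "\<forall>i. 0 \<le> r' i" "B \<subseteq> (\<Union>i. ball (c' i) (r' i))"
     "(\<Sum>i. ennreal (unit_ball_vol \<alpha> * r' i powr \<alpha>)) \<le> hausdorff_content \<alpha> B + ennreal (e / 2)"
    using cover[of B] fin by auto
  \<comment> \<open>Two coverings of excess at most \<open>e / 2\<close> are merged over the index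
    set of pairs of a Boolean and a natural number.\<close>
  define C where "C = (\<lambda>(b, i). if b then c i else c' i)"
  define R where "R = (\<lambda>(b, i). if b then r i else r' i)"
  have "A \<union> B \<subseteq> (\<Union>i\<in>UNIV. ball (C i) (R i))"
  proof -
    have "A \<subseteq> (\<Union>i. ball (C (True, i)) (R (True, i)))" "B \<subseteq> (\<Union>i. ball (C (False, i)) (R (False, i)))"
      using A(2) B(2) by (simp_all add: C_def R_def)
    then show ?thesis by blast
  qed
  then have "hausdorff_content \<alpha> (A \<union> B) \<le> (\<integral>\<^sup>+i. ennreal (unit_ball_vol \<alpha> * R i powr \<alpha>) \<partial>count_space UNIV)"
    using A(1) B(1) by (intro hausdorff_content_le_countable_cover) (auto simp: R_def split: prod.splits)
  also have "\<dots> = (\<integral>\<^sup>+b. \<integral>\<^sup>+i. ennreal (unit_ball_vol \<alpha> * R (b, i) powr \<alpha>) \<partial>count_space UNIV \<partial>count_space UNIV)"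
    by (rule nn_integral_fst_count_space[symmetric])
  also have "\<dots> = (\<Sum>i. ennreal (unit_ball_vol \<alpha> * r i powr \<alpha>)) + (\<Sum>i. ennreal (unit_ball_vol \<alpha> * r' i powr \<alpha>))"
    by (simp add: nn_integral_count_space_finite UNIV_bool R_def nn_integral_count_space_nat add.commute)
  also have "\<dots> \<le> (hausdorff_content \<alpha> A + ennreal (e / 2)) + (hausdorff_content \<alpha> B + ennreal (e / 2))"
    by (intro add_mono A B)
  also have "\<dots> = hausdorff_content \<alpha> A + hausdorff_content \<alpha> B + (ennreal (e / 2) + ennreal (e / 2))"
    by (simp add: ac_simps)
  also have "ennreal (e / 2) + ennreal (e / 2) = ennreal e"
    using \<open>0 < e\<close> by (simp flip: ennreal_plus)
  finally show "hausdorff_content \<alpha> (A \<union> B) \<le> hausdorff_content \<alpha> A + hausdorff_content \<alpha> B + ennreal e" .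
qed

lemma emeasure_le_hausdorff_content:
  fixes A :: "'a::euclidean_space set"
  assumes "A \<in> sets borel"
  shows "emeasure lborel A \<le> hausdorff_content (real DIM('a)) A"
  unfolding hausdorff_content_def
proof (rule Inf_greatest, clarify)
  fix c :: "nat \<Rightarrow> 'a" and r :: "nat \<Rightarrow> real"
  assume r: "\<forall>i. 0 \<le> r i" and cov: "A \<subseteq> (\<Union>i. ball (c i) (r i))"
  have "emeasure lborel A \<le> emeasure lborel (\<Union>i. ball (c i) (r i))"
    using cov by (intro emeasure_mono) auto
  also have "\<dots> \<le> (\<Sum>i. emeasure lborel (ball (c i) (r i)))"
    by (intro emeasure_subadditive_countably) auto
  also have "\<dots> = (\<Sum>i. ennreal (unit_ball_vol (real DIM('a)) * r i powr real DIM('a)))"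
  proof (intro suminf_cong)
    fix i
    show "emeasure lborel (ball (c i) (r i)) = ennreal (unit_ball_vol (real DIM('a)) * r i powr real DIM('a))"
      using r by (cases "r i = 0") (auto simp: emeasure_ball powr_realpow order_less_le)
  qed
  finally show "emeasure lborel A \<le> (\<Sum>i. ennreal (unit_ball_vol (real DIM('a)) * r i powr real DIM('a)))" .
qed

text \<open>A substitute for the set \<open>E\<close> that serves two estimates: for a superlevel
  set it contains every Lebesgue point with value above the level, and it contains almost all of
  \<open>E \<inter> \<Omega>\<close>. The bound on \<open>r\<close> provides the initial ball of the
  density argument.\<close>

definition dense_points :: "real \<Rightarrow> 'a::euclidean_space set \<Rightarrow> 'a set \<Rightarrow> 'a set" where
  "dense_points \<kappa> \<Omega> E = {x\<in>\<Omega>. \<exists>r. 0 < r \<and> r \<le> \<kappa> * bdist \<Omega> x \<and>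
     measure lborel (ball x r) / 2 < measure lborel (E \<inter> ball x r)}"

text \<open>The exponent \<open>\<alpha>\<close> is left free because two values are used:
  \<open>s * (n - \<delta>)\<close> for the Choquet integral and \<open>n\<close> to dominate
  Lebesgue measure. \<open>K\<close> is fixed before both \<open>\<alpha>\<close> and
  \<open>\<delta>\<close>.\<close>

lemma boxing_inequality:
  fixes \<tau> s C D :: real
  assumes \<tau>: "0 < \<tau>" "\<tau> < 1" and s: "1 \<le> s"
  obtains K where "0 < K" "\<And>\<delta> \<alpha> \<Omega> x\<^sub>J (E :: 'a::euclidean_space set).
    john_domain_with_center s C x\<^sub>J \<Omega> \<Longrightarrow> diameter \<Omega> = D \<Longrightarrow> E \<in> sets borel \<Longrightarrow> 0 < \<delta> \<Longrightarrow> \<delta> < 1 \<Longrightarrow>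
    s * (real DIM('a) - \<delta>) \<le> \<alpha> \<Longrightarrow> \<alpha> \<le> real DIM('a) \<Longrightarrow>
    measure lborel (E \<inter> ball x\<^sub>J (\<tau> / 4 * bdist \<Omega> x\<^sub>J)) \<le> measure lborel (ball x\<^sub>J (\<tau> / 4 * bdist \<Omega> x\<^sub>J)) / 2 \<Longrightarrow>
    hausdorff_content \<alpha> (dense_points (\<tau> / 4) \<Omega> E) \<le> ennreal (K * (1 - \<delta>)) * frac_energy \<tau> \<delta> \<Omega> (indicator E)"
proof -
  let ?n = "real DIM('a)"
  obtain U where U: "0 < U" "\<And>\<alpha>. 0 \<le> \<alpha> \<Longrightarrow> \<alpha> \<le> ?n \<Longrightarrow> unit_ball_vol \<alpha> \<le> U"
    using unit_ball_vol_bounded[of ?n] by blast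
  define \<beta> where "\<beta> = (unit_ball_vol ?n / 2) ^ 2 / 3 ^ (DIM('a) + 1)"
  define M where "M = 5 * cover_factor s C (\<tau> / 4) D"
  define Q where "Q = max 1 M powr ?n * max 1 D powr ?n"
  have \<beta>: "0 < \<beta>"
    using unit_ball_vol_pos[of ?n] by (simp add: \<beta>_def del: unit_ball_vol_pos)
  have M: "0 \<le> M" by (simp add: M_def cover_factor_def)
  have Q: "0 < Q" by (simp add: Q_def)
  show thesis
  proof (rule that[of "U * Q / \<beta>"])
    show "0 < U * Q / \<beta>" using U Q \<beta> by simp
    fix \<delta> \<alpha> :: real and \<Omega> :: "'a set" and x\<^sub>J E
    assume J: "john_domain_with_center s C x\<^sub>J \<Omega>" and D: "diameter \<Omega> = D" and E: "E \<in> sets borel"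
      and \<delta>: "0 < \<delta>" "\<delta> < 1" and \<alpha>: "s * (?n - \<delta>) \<le> \<alpha>" "\<alpha> \<le> ?n"
      and sparse: "measure lborel (E \<inter> ball x\<^sub>J (\<tau> / 4 * bdist \<Omega> x\<^sub>J)) \<le> measure lborel (ball x\<^sub>J (\<tau> / 4 * bdist \<Omega> x\<^sub>J)) / 2"
    have n\<delta>: "0 < ?n - \<delta>"
      using \<delta> DIM_positive[where 'a='a] by linarith
    then have "0 < s * (?n - \<delta>)"
      using s by simp
    then have \<alpha>0: "0 < \<alpha>"
      using \<alpha>(1) by (rule less_le_trans)
    obtain I c r where I: "countable (I :: 'a set)" "\<And>i. i \<in> I \<Longrightarrow> 0 < r i \<and> r i \<le> D"
      "dense_points (\<tau> / 4) \<Omega> E \<subseteq> (\<Union>i\<in>I. ball (c i) (5 * (cover_factor s C (\<tau> / 4) D * r i powr (1 / s))))"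
      "(\<integral>\<^sup>+i. ennreal (\<beta> * r i powr (?n - \<delta>)) \<partial>count_space I) \<le> ennreal (1 - \<delta>) * frac_energy \<tau> \<delta> \<Omega> (indicator E)"
    proof (rule boxing_cover[OF J E \<tau> \<delta> sparse, of "dense_points (\<tau> / 4) \<Omega> E", folded \<beta>_def, unfolded D])
      fix I :: "'a set" and c :: "'a \<Rightarrow> 'a" and r :: "'a \<Rightarrow> real"
      assume "countable I" "\<And>i. i \<in> I \<Longrightarrow> 0 < r i \<and> r i \<le> D"
        "dense_points (\<tau> / 4) \<Omega> E \<subseteq> (\<Union>i\<in>I. ball (c i) (5 * (cover_factor s C (\<tau> / 4) D * r i powr (1 / s))))"
        "(\<integral>\<^sup>+i. ennreal (\<beta> * r i powr (?n - \<delta>)) \<partial>count_space I) \<le> ennreal (1 - \<delta>) * frac_energy \<tau> \<delta> \<Omega> (indicator E)"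
      then show thesis
        by (rule that)
    qed (simp add: dense_points_def)
    have R: "unit_ball_vol \<alpha> * (M * r i powr (1 / s)) powr \<alpha> \<le> (U * Q / \<beta>) * (\<beta> * r i powr (?n - \<delta>))" if "i \<in> I" for i
    proof -
      have ri: "0 < r i" "r i \<le> D" using I(2)[OF that] by auto
      have e0: "0 \<le> \<alpha> / s - (?n - \<delta>)"
        using \<alpha>(1) s by (simp add: le_divide_eq mult.commute)
      have "\<alpha> / s \<le> \<alpha>"
        using s \<alpha>0 by (simp add: divide_le_eq)
      then have e1: "\<alpha> / s - (?n - \<delta>) \<le> ?n"
        using \<alpha>(2) n\<delta> by linarith
      \<comment> \<open>The surplus exponent lies between 0 and \<open>?n\<close>, so a power of
        \<open>max 1 D\<close> bounds the surplus uniformly in \<open>\<alpha>\<close> and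
        \<open>\<delta>\<close>; the maximum with 1 makes powers monotone in the exponent.\<close>
      have "r i powr (\<alpha> / s) = r i powr (\<alpha> / s - (?n - \<delta>)) * r i powr (?n - \<delta>)"
        using ri by (simp add: powr_add[symmetric])
      also have "r i powr (\<alpha> / s - (?n - \<delta>)) \<le> max 1 D powr (\<alpha> / s - (?n - \<delta>))"
        using ri e0 by (intro powr_mono2) auto
      also have "\<dots> \<le> max 1 D powr ?n"
        using e1 by (intro powr_mono) auto
      finally have 1: "r i powr (\<alpha> / s) \<le> max 1 D powr ?n * r i powr (?n - \<delta>)"
        by (simp add: mult_right_mono)
      have "M powr \<alpha> \<le> max 1 M powr \<alpha>"
        using M \<alpha>0 by (intro powr_mono2) auto
      also have "\<dots> \<le> max 1 M powr ?n"
        using \<alpha>(2) by (intro powr_mono) auto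
      finally have 2: "M powr \<alpha> \<le> max 1 M powr ?n" .
      have "unit_ball_vol \<alpha> * (M * r i powr (1 / s)) powr \<alpha> = unit_ball_vol \<alpha> * (M powr \<alpha> * r i powr (\<alpha> / s))"
        using M by (simp add: powr_mult powr_powr)
      also have "\<dots> \<le> U * (max 1 M powr ?n * (max 1 D powr ?n * r i powr (?n - \<delta>)))"
        using U \<alpha>0 \<alpha>(2) 1 2 by (intro mult_mono) auto
      also have "\<dots> = (U * Q / \<beta>) * (\<beta> * r i powr (?n - \<delta>))"
        using \<beta> by (simp add: Q_def)
      finally show ?thesis .
    qed
    have "hausdorff_content \<alpha> (dense_points (\<tau> / 4) \<Omega> E) \<le>
      (\<integral>\<^sup>+i. ennreal (unit_ball_vol \<alpha> * (M * r i powr (1 / s)) powr \<alpha>) \<partial>count_space I)"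
      using I(1,3) M by (intro hausdorff_content_le_countable_cover) (auto simp: M_def mult.assoc)
    also have "\<dots> \<le> (\<integral>\<^sup>+i. ennreal (U * Q / \<beta>) * ennreal (\<beta> * r i powr (?n - \<delta>)) \<partial>count_space I)"
      using R U Q \<beta> by (intro nn_integral_mono) (auto simp: ennreal_mult[symmetric] intro!: ennreal_leI)
    also have "\<dots> = ennreal (U * Q / \<beta>) * (\<integral>\<^sup>+i. ennreal (\<beta> * r i powr (?n - \<delta>)) \<partial>count_space I)"
      by (rule nn_integral_cmult) simp
    also have "\<dots> \<le> ennreal (U * Q / \<beta>) * (ennreal (1 - \<delta>) * frac_energy \<tau> \<delta> \<Omega> (indicator E))"
      using I(4) by (rule mult_left_mono) simp
    also have "\<dots> = ennreal (U * Q / \<beta> * (1 - \<delta>)) * frac_energy \<tau> \<delta> \<Omega> (indicator E)"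
      using U Q \<beta> \<delta> by (subst ennreal_mult) (auto simp: mult.assoc)
    finally show "hausdorff_content \<alpha> (dense_points (\<tau> / 4) \<Omega> E) \<le> ennreal (U * Q / \<beta> * (1 - \<delta>)) * frac_energy \<tau> \<delta> \<Omega> (indicator E)" .
  qed
qed

section \<open>Almost every point of a set is a dense point\<close>

text \<open>A form of the density theorem. Small disjoint balls centered in \<open>?N\<close>
  exhaust it up to a null set and stay in an open \<open>T\<close> of measure close to that of
  \<open>?N\<close>. Each ball is at most half filled, so the measure of \<open>?N\<close> is at
  most half the sum of itself and \<open>\<epsilon>\<close>, hence at most
  \<open>\<epsilon>\<close>. The cut-off by \<open>cball 0 k\<close> makes this subtraction
  legitimate.\<close>

lemma sparse_points_null:
  fixes E :: "'a::euclidean_space set"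
  assumes E [measurable]: "E \<in> sets borel" and "0 < \<rho>"
  defines "N \<equiv> {x\<in>E. \<forall>r. 0 < r \<and> r \<le> \<rho> \<longrightarrow> measure lborel (E \<inter> ball x r) \<le> measure lborel (ball x r) / 2}"
  shows "N \<inter> cball 0 k \<in> null_sets lborel"
proof -
  let ?N = "N \<inter> cball 0 k"
  \<comment> \<open>An uncountable intersection over the radii is measurable because each condition
    is closed in \<open>x\<close>.\<close>
  have "closed {x. measure lborel (E \<inter> ball x r) - measure lborel (ball x r) / 2 \<le> 0}" for r
    by (intro closed_Collect_le continuous_on_ball_excess E continuous_intros)
  then have "closed {x. measure lborel (E \<inter> ball x r) \<le> measure lborel (ball x r) / 2}" for r
    by simp
  then have "closed (\<Inter>r\<in>{0<..\<rho>}. {x. measure lborel (E \<inter> ball x r) \<le> measure lborel (ball x r) / 2})"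
    by blast
  moreover have "N = E \<inter> (\<Inter>r\<in>{0<..\<rho>}. {x. measure lborel (E \<inter> ball x r) \<le> measure lborel (ball x r) / 2})"
    unfolding N_def by auto
  ultimately have [measurable]: "N \<in> sets borel"
    by auto
  have Nm: "?N \<in> lmeasurable"
    by (intro bounded_set_imp_lmeasurable bounded_Int) auto
  have eN: "emeasure lborel ?N = ennreal (measure lborel ?N)"
    using emeasure_eq_measure2[OF Nm] by simp
  have "emeasure lborel ?N \<le> ennreal \<epsilon>" if "0 < \<epsilon>" for \<epsilon>
  proof -
    obtain T where T: "open T" "?N \<subseteq> T" "emeasure lebesgue (T - ?N) < ennreal \<epsilon>"
      using sets_lebesgue_outer_open[OF fmeasurableD[OF Nm] \<open>0 < \<epsilon>\<close>] by blast
    \<comment> \<open>Balls are indexed by center and radius together, as the covering theorem needs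
      arbitrarily small balls at every point.\<close>
    define P where "P = {(x, r). x \<in> ?N \<and> 0 < r \<and> r \<le> \<rho> \<and> ball x r \<subseteq> T}"
    have "\<exists>i. i \<in> P \<and> x \<in> ball (fst i) (snd i) \<and> snd i < d" if x: "x \<in> ?N" "0 < d" for x d
    proof -
      obtain e where "0 < e" "ball x e \<subseteq> T"
        using T(1,2) x by (meson open_contains_ball subsetD)
      then show ?thesis
        using x \<open>0 < \<rho>\<close> by (intro exI[of _ "(x, min e (min \<rho> (d / 2)))"]) (auto simp: P_def)
    qed
    then obtain I where I: "countable I" "I \<subseteq> P"
      "pairwise (\<lambda>i j. disjnt (ball (fst i) (snd i)) (ball (fst j) (snd j))) I"
      "negligible (?N - (\<Union>i\<in>I. ball (fst i) (snd i)))"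
      using Vitali_covering_theorem_balls[of ?N P fst snd] by blast
    let ?B = "\<lambda>i. ball (fst i) (snd i)"
    have dj: "disjoint_family_on ?B I"
      using I(3) unfolding pairwise_def disjoint_family_on_def disjnt_def by blast
    then have dj': "disjoint_family_on (\<lambda>i. ?N \<inter> ?B i) I"
      unfolding disjoint_family_on_def by blast
    have sB: "?N - (\<Union>i\<in>I. ?B i) \<in> sets lborel"
      using \<open>N \<in> sets borel\<close> by (simp add: sets.Diff sets.Int borel_open open_UN)
    have "?N - (\<Union>i\<in>I. ?B i) \<in> null_sets lborel"
      using I(4) sB by (simp add: negligible_iff_null_sets null_sets_completion_iff)
    then have "emeasure lborel ?N = emeasure lborel (?N - (?N - (\<Union>i\<in>I. ?B i)))"
      by (intro emeasure_Diff_null_set[symmetric]) auto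
    also have "?N - (?N - (\<Union>i\<in>I. ?B i)) = (\<Union>i\<in>I. ?N \<inter> ?B i)"
      by auto
    also have "emeasure lborel \<dots> = (\<integral>\<^sup>+i. emeasure lborel (?N \<inter> ?B i) \<partial>count_space I)"
      by (intro emeasure_UN_countable I(1) dj') auto
    also have "\<dots> \<le> (\<integral>\<^sup>+i. ennreal (1 / 2) * emeasure lborel (?B i) \<partial>count_space I)"
    proof (intro nn_integral_mono)
      fix i assume "i \<in> space (count_space I)"
      then have i: "fst i \<in> N" "0 < snd i" "snd i \<le> \<rho>"
        using I(2) by (auto simp: P_def)
      have fin: "emeasure lborel (?B i) \<noteq> \<infinity>" "emeasure lborel (E \<inter> ?B i) \<noteq> \<infinity>"
        using emeasure_bounded_finite[of "?B i"] emeasure_bounded_finite[of "E \<inter> ?B i"]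
        by (auto simp: bounded_Int)
      have "emeasure lborel (?N \<inter> ?B i) \<le> emeasure lborel (E \<inter> ?B i)"
        by (intro emeasure_mono) (auto simp: N_def)
      also have "\<dots> = ennreal (measure lborel (E \<inter> ?B i))"
        using fin by (simp add: emeasure_eq_ennreal_measure)
      also have "\<dots> \<le> ennreal (measure lborel (?B i) / 2)"
        using i by (intro ennreal_leI) (auto simp: N_def)
      also have "\<dots> = ennreal (1 / 2 * measure lborel (?B i))"
        by simp
      also have "\<dots> = ennreal (1 / 2) * ennreal (measure lborel (?B i))"
        by (rule ennreal_mult) auto
      also have "\<dots> = ennreal (1 / 2) * emeasure lborel (?B i)"
        by (simp only: emeasure_eq_ennreal_measure[OF fin(1)[unfolded infinity_ennreal_def]])
      finally show "emeasure lborel (?N \<inter> ?B i) \<le> ennreal (1 / 2) * emeasure lborel (?B i)" .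
    qed
    also have "\<dots> = ennreal (1 / 2) * (\<integral>\<^sup>+i. emeasure lborel (?B i) \<partial>count_space I)"
      by (rule nn_integral_cmult) simp
    also have "(\<integral>\<^sup>+i. emeasure lborel (?B i) \<partial>count_space I) = emeasure lborel (\<Union>i\<in>I. ?B i)"
      by (intro emeasure_UN_countable[symmetric] I(1) dj) auto
    also have "\<dots> \<le> emeasure lborel T"
    proof (rule emeasure_mono)
      have "?B i \<subseteq> T" if "i \<in> I" for i
        using subsetD[OF I(2) that] by (auto simp: P_def simp del: mem_ball)
      then show "(\<Union>i\<in>I. ?B i) \<subseteq> T"
        by blast
    qed (use T(1) in auto)
    also have "emeasure lborel T = emeasure lborel ?N + emeasure lborel (T - ?N)"
      using T(1,2) by (subst plus_emeasure) (auto intro!: arg_cong[where f="emeasure lborel"])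
    also have "\<dots> \<le> ennreal (measure lborel ?N) + ennreal \<epsilon>"
      using T(1,3) eN by (intro add_mono) auto
    also have "\<dots> = ennreal (measure lborel ?N + \<epsilon>)"
      using \<open>0 < \<epsilon>\<close> by simp
    finally have "emeasure lborel ?N \<le> ennreal (1 / 2) * ennreal (measure lborel ?N + \<epsilon>)"
      by (simp add: mult_left_mono)
    also have "\<dots> = ennreal (1 / 2 * (measure lborel ?N + \<epsilon>))"
      using \<open>0 < \<epsilon>\<close> by (intro ennreal_mult[symmetric]) auto
    finally have "measure lborel ?N \<le> 1 / 2 * (measure lborel ?N + \<epsilon>)"
      unfolding eN using \<open>0 < \<epsilon>\<close> by (subst (asm) ennreal_le_iff) auto
    then show ?thesis
      unfolding eN by (intro ennreal_leI) simp
  qed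
  then have "emeasure lborel ?N = 0"
    by (metis ennreal_le_epsilon le_zero_eq add_0 zero_le)
  then show ?thesis
    by (intro null_setsI) auto
qed

text \<open>Countably many scales \<open>1 / (i + 1)\<close> and balls of radius \<open>j\<close>
  suffice: for each point some scale lies below its own threshold
  \<open>\<kappa> * bdist \<Omega> x\<close>.\<close>

lemma AE_dense_points:
  fixes E \<Omega> :: "'a::euclidean_space set"
  assumes [measurable]: "E \<in> sets borel" and pos: "\<And>x. x \<in> \<Omega> \<Longrightarrow> 0 < bdist \<Omega> x" and "0 < \<kappa>"
  shows "AE x in lborel. x \<in> E \<inter> \<Omega> \<longrightarrow> x \<in> dense_points \<kappa> \<Omega> E"
proof -
  define N where "N \<rho> = {x\<in>E. \<forall>r. 0 < r \<and> r \<le> \<rho> \<longrightarrow> measure lborel (E \<inter> ball x r) \<le> measure lborel (ball x r) / 2}" for \<rho>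
  have "AE x in lborel. \<forall>i j :: nat. x \<notin> N (1 / real (Suc i)) \<inter> cball 0 (real j)"
    unfolding AE_all_countable N_def by (intro allI AE_not_in sparse_points_null) auto
  then show ?thesis
  proof eventually_elim
    case (elim x)
    show ?case
    proof
      assume x: "x \<in> E \<inter> \<Omega>"
      then have "0 < \<kappa> * bdist \<Omega> x"
        using pos \<open>0 < \<kappa>\<close> by simp
      then obtain i where i: "1 / real (Suc i) < \<kappa> * bdist \<Omega> x"
        using reals_Archimedean by (auto simp: inverse_eq_divide)
      obtain j :: nat where "norm x \<le> real j"
        using real_arch_simple by blast
      then have "x \<notin> N (1 / real (Suc i))"
        using elim by auto
      then show "x \<in> dense_points \<kappa> \<Omega> E"
        using x i by (fastforce simp: N_def dense_points_def not_le)
    qed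
  qed
qed

text \<open>The Borel set obtained by removing a null set from \<open>E \<inter> \<Omega>\<close>
  lies inside \<open>dense_points\<close>, so the comparison rests on monotonicity of the content
  and not on measurability of \<open>dense_points\<close>.\<close>

lemma emeasure_le_hausdorff_content_dense_points:
  fixes E \<Omega> :: "'a::euclidean_space set"
  assumes [measurable]: "E \<in> sets borel" and "open \<Omega>" "\<And>x. x \<in> \<Omega> \<Longrightarrow> 0 < bdist \<Omega> x" and "0 < \<kappa>"
  shows "emeasure lborel (E \<inter> \<Omega>) \<le> hausdorff_content (real DIM('a)) (dense_points \<kappa> \<Omega> E)"
proof -
  have [measurable]: "\<Omega> \<in> sets borel"
    using \<open>open \<Omega>\<close> by simp
  obtain N where N: "{x. \<not> (x \<in> E \<inter> \<Omega> \<longrightarrow> x \<in> dense_points \<kappa> \<Omega> E)} \<subseteq> N" "N \<in> null_sets lborel"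
    using AE_dense_points[OF assms(1,3,4)] by (auto elim!: AE_E simp: null_sets_def)
  then have [measurable]: "N \<in> sets borel"
    by auto
  have "emeasure lborel (E \<inter> \<Omega>) = emeasure lborel (E \<inter> \<Omega> - N)"
    using N(2) by (intro emeasure_Diff_null_set[symmetric]) auto
  also have "\<dots> \<le> hausdorff_content (real DIM('a)) (E \<inter> \<Omega> - N)"
    by (rule emeasure_le_hausdorff_content) measurable
  also have "\<dots> \<le> hausdorff_content (real DIM('a)) (dense_points \<kappa> \<Omega> E)"
    using N(1) by (intro hausdorff_content_mono) auto
  finally show ?thesis .
qed

section \<open>Coarea formula and medians\<close>

text \<open>The two indicators differ exactly when \<open>t + c\<close> lies in
  \<open>{min a b..<max a b}\<close>, an interval of length
  \<open>\<bar>a - b\<bar>\<close>.\<close>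

lemma ennreal_abs_diff_eq_nn_integral_superlevel:
  fixes a b c d :: real
  assumes "0 \<le> d"
  shows "ennreal (\<bar>a - b\<bar> / d) =
    (\<integral>\<^sup>+t. ennreal (\<bar>(if t + c < a then 1 else 0) - (if t + c < b then 1 else 0)\<bar> / d) \<partial>lborel)"
proof -
  have "(\<integral>\<^sup>+t. ennreal (\<bar>(if t + c < a then 1 else 0) - (if t + c < b then 1 else 0)\<bar> / d) \<partial>lborel)
    = (\<integral>\<^sup>+t. ennreal (1 / d) * indicator {min a b - c..<max a b - c} t \<partial>lborel)"
    by (intro nn_integral_cong) (auto simp: indicator_def)
  also have "\<dots> = ennreal (1 / d) * ennreal (max a b - min a b)"
    by (subst nn_integral_cmult_indicator) auto
  also have "\<dots> = ennreal (\<bar>a - b\<bar> / d)"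
    using assms by (subst ennreal_mult[symmetric]) (auto simp: max_def min_def)
  finally show ?thesis ..
qed

context
  fixes \<Omega> :: "'a::euclidean_space set" and g :: "'a \<Rightarrow> real" and c \<delta> \<tau> :: real
  assumes \<Omega>: "open \<Omega>" and g [measurable]: "g \<in> borel_measurable borel"
begin

text \<open>The integrand of the energy of a superlevel set. Conditionals replace indicators of sets
  that move with \<open>t\<close> and \<open>y\<close>, so joint measurability in all three
  variables comes down to comparisons.\<close>

definition level_kernel :: "real \<Rightarrow> 'a \<Rightarrow> 'a \<Rightarrow> ennreal" where
  "level_kernel t y x = ennreal (\<bar>(if t + c < g x then 1 else 0) - (if t + c < g y then 1 else 0)\<bar>
     / dist x y powr (real DIM('a) + \<delta>))
    * (if x \<in> \<Omega> \<and> dist x y < \<tau> * bdist \<Omega> y then 1 else 0) * (if y \<in> \<Omega> then 1 else 0)"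

lemma borel_measurable_level_kernel [measurable]:
  assumes [measurable]: "t \<in> borel_measurable M" "y \<in> borel_measurable M" "x \<in> borel_measurable M"
  shows "(\<lambda>z. level_kernel (t z) (y z) (x z)) \<in> borel_measurable M"
proof -
  have [measurable]: "\<Omega> \<in> sets borel" using \<Omega> by simp
  have [measurable]: "bdist \<Omega> \<in> borel_measurable borel"
    unfolding bdist_def by (intro borel_measurable_continuous_onI continuous_intros)
  show ?thesis
    unfolding level_kernel_def by measurable
qed

lemma frac_energy_level:
  "frac_energy \<tau> \<delta> \<Omega> (indicator {x. t + c < g x}) = (\<integral>\<^sup>+y. \<integral>\<^sup>+x. level_kernel t y x \<partial>lborel \<partial>lborel)"
proof -
  have "(\<integral>\<^sup>+x. level_kernel t y x \<partial>lborel) = (\<integral>\<^sup>+x\<in>{x\<in>\<Omega>. dist x y < \<tau> * bdist \<Omega> y}.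
     ennreal (\<bar>indicator {x. t + c < g x} x - indicator {x. t + c < g x} y\<bar> / dist x y powr (real DIM('a) + \<delta>)) \<partial>lborel)
     * indicator \<Omega> y" for y
  proof (cases "y \<in> \<Omega>")
    case True
    then have "indicator \<Omega> y = (1 :: ennreal)" by simp
    show ?thesis
      unfolding \<open>indicator \<Omega> y = (1 :: ennreal)\<close> mult_1_right
      by (intro nn_integral_cong) (use True in \<open>auto simp: level_kernel_def indicator_def\<close>)
  qed (simp add: level_kernel_def)
  then show ?thesis
    unfolding frac_energy_def by (simp add: nn_integral_completion)
qed

lemma borel_measurable_frac_energy_level:
  "(\<lambda>t. frac_energy \<tau> \<delta> \<Omega> (indicator {x. t + c < g x})) \<in> borel_measurable borel"
  unfolding frac_energy_level by measurable

text \<open>For fixed \<open>x\<close> and \<open>y\<close> the integral over \<open>t\<close>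
  restores the difference of the values of \<open>g\<close>; the rest is Tonelli.\<close>

lemma frac_energy_coarea:
  "(\<integral>\<^sup>+t. frac_energy \<tau> \<delta> \<Omega> (indicator {x. t + c < g x}) \<partial>lborel) = frac_energy \<tau> \<delta> \<Omega> g"
proof -
  have "(\<integral>\<^sup>+t. frac_energy \<tau> \<delta> \<Omega> (indicator {x. t + c < g x}) \<partial>lborel)
    = (\<integral>\<^sup>+y. \<integral>\<^sup>+t. \<integral>\<^sup>+x. level_kernel t y x \<partial>lborel \<partial>lborel \<partial>lborel)"
    unfolding frac_energy_level by (rule lborel_pair.Fubini') measurable
  also have "\<dots> = (\<integral>\<^sup>+y. \<integral>\<^sup>+x. \<integral>\<^sup>+t. level_kernel t y x \<partial>lborel \<partial>lborel \<partial>lborel)"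
    by (rule nn_integral_cong, rule lborel_pair.Fubini') measurable
  also have "\<dots> = (\<integral>\<^sup>+y. \<integral>\<^sup>+x. ennreal (\<bar>g x - g y\<bar> / dist x y powr (real DIM('a) + \<delta>))
    * (if x \<in> \<Omega> \<and> dist x y < \<tau> * bdist \<Omega> y then 1 else 0) * (if y \<in> \<Omega> then 1 else 0) \<partial>lborel \<partial>lborel)"
    unfolding level_kernel_def
    by (intro nn_integral_cong, subst ennreal_abs_diff_eq_nn_integral_superlevel[where c=c])
      (auto simp: nn_integral_multc)
  also have "\<dots> = frac_energy \<tau> \<delta> \<Omega> g"
    unfolding frac_energy_def by (auto simp: nn_integral_completion nn_integral_multc[symmetric] indicator_def intro!: nn_integral_cong)
  finally show ?thesis .
qed

end

text \<open>The median is the infimum of the levels whose strict superlevel set fills at most half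
  of \<open>B\<close>. Continuity of the measure along increasing unions carries the bounds from
  levels above and below \<open>m\<close> to \<open>m\<close> itself.\<close>

lemma median_exists:
  fixes g :: "'a::euclidean_space \<Rightarrow> real"
  assumes [measurable]: "g \<in> borel_measurable borel" "B \<in> sets borel" and "bounded B" and pos: "0 < measure lborel B"
  obtains m where "measure lborel ({x. m < g x} \<inter> B) \<le> measure lborel B / 2"
    "measure lborel ({x. g x < m} \<inter> B) \<le> measure lborel B / 2"
proof -
  let ?\<mu> = "measure lborel"
  define F where "F t = ?\<mu> ({x. t < g x} \<inter> B)" for t
  have fm: "A \<inter> B \<in> fmeasurable lborel" if "A \<in> sets borel" for A
    using that emeasure_bounded_finite[of "A \<inter> B"] \<open>bounded B\<close>
    by (intro fmeasurableI) (auto simp: bounded_Int)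
  have fin: "emeasure lborel (A \<inter> B) \<noteq> \<infinity>" for A
    using emeasure_bounded_finite[of "A \<inter> B"] \<open>bounded B\<close> by (auto simp: bounded_Int)
  have sets [measurable]: "{x. t < g x} \<in> sets borel" "{x. g x < t} \<in> sets borel" "{x. g x \<le> t} \<in> sets borel" for t
    by measurable
  have mono: "F t \<le> F u" if "u \<le> t" for t u
    unfolding F_def using that by (intro measure_mono_fmeasurable fm sets) auto
  \<comment> \<open>Letting the level tend to plus and to minus infinity shows that the set
    \<open>S\<close> below is nonempty and bounded from below.\<close>
  have "(\<lambda>n. ?\<mu> ({x. real n < g x} \<inter> B)) \<longlonglongrightarrow> ?\<mu> (\<Inter>n. {x. real n < g x} \<inter> B)"
    by (intro Lim_measure_decseq fin) (auto simp: decseq_def intro: le_less_trans)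
  moreover have "(\<Inter>n. {x. real n < g x} \<inter> B) = {}"
    by (auto simp: not_less) (meson less_le_not_le real_arch_simple)
  ultimately have "(\<lambda>n. F (real n)) \<longlonglongrightarrow> 0"
    by (simp add: F_def)
  then have "\<forall>\<^sub>F n in sequentially. F (real n) < ?\<mu> B / 2"
    by (rule order_tendstoD) (use pos in simp)
  then obtain t\<^sub>1 where t1: "F t\<^sub>1 \<le> ?\<mu> B / 2"
    by (auto simp: eventually_sequentially intro: less_imp_le)
  have "(\<lambda>n. ?\<mu> ({x. - real n < g x} \<inter> B)) \<longlonglongrightarrow> ?\<mu> (\<Union>n. {x. - real n < g x} \<inter> B)"
  proof (intro Lim_measure_incseq)
    show "incseq (\<lambda>n. {x. - real n < g x} \<inter> B)"
      by (auto simp: incseq_def intro: le_less_trans[rotated])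
    show "emeasure lborel (\<Union>n. {x. - real n < g x} \<inter> B) \<noteq> \<infinity>"
      using fin[of "\<Union>n. {x. - real n < g x}"] by (simp add: Int_UN_distrib2)
  qed auto
  moreover have "(\<Union>n. {x. - real n < g x} \<inter> B) = B"
    by auto (metis minus_less_iff reals_Archimedean2)
  ultimately have "(\<lambda>n. F (- real n)) \<longlonglongrightarrow> ?\<mu> B"
    by (simp add: F_def)
  then have "\<forall>\<^sub>F n in sequentially. ?\<mu> B / 2 < F (- real n)"
    by (rule order_tendstoD) (use pos in simp)
  then obtain t\<^sub>0 where t0: "?\<mu> B / 2 < F t\<^sub>0"
    by (auto simp: eventually_sequentially)
  define S where "S = {t. F t \<le> ?\<mu> B / 2}"
  have bdd: "bdd_below S"
  proof (rule bdd_belowI)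
    fix t assume "t \<in> S"
    then show "t\<^sub>0 \<le> t"
      using t0 mono[of t t\<^sub>0] by (force simp: S_def)
  qed
  have ne: "S \<noteq> {}"
    using t1 by (auto simp: S_def)
  define m where "m = Inf S"
  have above: "F t \<le> ?\<mu> B / 2" if t: "m < t" for t
  proof -
    obtain u where "u \<in> S" "u < t"
      using cInf_lessD[OF ne, of t] t by (auto simp: m_def)
    then show ?thesis
      using mono[of u t] by (auto simp: S_def)
  qed
  have below: "?\<mu> B / 2 < F t" if "t < m" for t
    using that cInf_lower[OF _ bdd, of t] by (force simp: m_def S_def)
  have "(\<lambda>n. ?\<mu> ({x. m + 1 / real (Suc n) < g x} \<inter> B)) \<longlonglongrightarrow> ?\<mu> (\<Union>n. {x. m + 1 / real (Suc n) < g x} \<inter> B)"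
  proof (intro Lim_measure_incseq)
    show "incseq (\<lambda>n. {x. m + 1 / real (Suc n) < g x} \<inter> B)"
    proof (intro incseq_SucI)
      fix n
      have "1 / real (Suc (Suc n)) \<le> 1 / real (Suc n)"
        by (intro divide_left_mono) auto
      then show "{x. m + 1 / real (Suc n) < g x} \<inter> B \<subseteq> {x. m + 1 / real (Suc (Suc n)) < g x} \<inter> B"
        by auto
    qed
    show "emeasure lborel (\<Union>n. {x. m + 1 / real (Suc n) < g x} \<inter> B) \<noteq> \<infinity>"
      using fin[of "\<Union>n. {x. m + 1 / real (Suc n) < g x}"] by (simp add: Int_UN_distrib2)
  qed auto
  moreover have "(\<Union>n. {x. m + 1 / real (Suc n) < g x} \<inter> B) = {x. m < g x} \<inter> B"
  proof (intro equalityI subsetI)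
    fix x assume x: "x \<in> {x. m < g x} \<inter> B"
    then obtain n where "1 / real (Suc n) < g x - m"
      using reals_Archimedean[of "g x - m"] by (auto simp: inverse_eq_divide)
    then have "m + 1 / real (Suc n) < g x"
      by linarith
    then show "x \<in> (\<Union>n. {x. m + 1 / real (Suc n) < g x} \<inter> B)"
      using x by blast
  next
    fix x assume "x \<in> (\<Union>n. {x. m + 1 / real (Suc n) < g x} \<inter> B)"
    then obtain n where "x \<in> B" "m + 1 / real (Suc n) < g x" by auto
    moreover have "0 < 1 / real (Suc n)" by simp
    ultimately have "m < g x" by linarith
    with \<open>x \<in> B\<close> show "x \<in> {x. m < g x} \<inter> B"
      by simp
  qed
  moreover have "?\<mu> ({x. m + 1 / real (Suc n) < g x} \<inter> B) \<le> ?\<mu> B / 2" for n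
    using above[of "m + 1 / real (Suc n)"] by (simp add: F_def)
  ultimately have "?\<mu> ({x. m < g x} \<inter> B) \<le> ?\<mu> B / 2"
    by (intro LIMSEQ_le_const2[where X="\<lambda>n. ?\<mu> ({x. m + 1 / real (Suc n) < g x} \<inter> B)"]) auto
  moreover have "?\<mu> ({x. g x < m} \<inter> B) \<le> ?\<mu> B / 2"
  proof -
    have "(\<lambda>n. ?\<mu> ({x. g x \<le> m - 1 / real (Suc n)} \<inter> B)) \<longlonglongrightarrow> ?\<mu> (\<Union>n. {x. g x \<le> m - 1 / real (Suc n)} \<inter> B)"
    proof (intro Lim_measure_incseq)
      show "incseq (\<lambda>n. {x. g x \<le> m - 1 / real (Suc n)} \<inter> B)"
      proof (intro incseq_SucI)
        fix n
        have "1 / real (Suc (Suc n)) \<le> 1 / real (Suc n)"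
          by (intro divide_left_mono) auto
        then show "{x. g x \<le> m - 1 / real (Suc n)} \<inter> B \<subseteq> {x. g x \<le> m - 1 / real (Suc (Suc n))} \<inter> B"
          by auto
      qed
      show "emeasure lborel (\<Union>n. {x. g x \<le> m - 1 / real (Suc n)} \<inter> B) \<noteq> \<infinity>"
        using fin[of "\<Union>n. {x. g x \<le> m - 1 / real (Suc n)}"] by (simp add: Int_UN_distrib2)
    qed auto
    moreover have "(\<Union>n. {x. g x \<le> m - 1 / real (Suc n)} \<inter> B) = {x. g x < m} \<inter> B"
    proof (intro equalityI subsetI)
      fix x assume x: "x \<in> {x. g x < m} \<inter> B"
      then obtain n where "1 / real (Suc n) < m - g x"
        using reals_Archimedean[of "m - g x"] by (auto simp: inverse_eq_divide)
      then have "g x \<le> m - 1 / real (Suc n)"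
        by linarith
      then show "x \<in> (\<Union>n. {x. g x \<le> m - 1 / real (Suc n)} \<inter> B)"
        using x by blast
    next
      fix x assume "x \<in> (\<Union>n. {x. g x \<le> m - 1 / real (Suc n)} \<inter> B)"
      then obtain n where "x \<in> B" "g x \<le> m - 1 / real (Suc n)" by auto
      moreover have "0 < 1 / real (Suc n)" by simp
      ultimately have "g x < m" by linarith
      with \<open>x \<in> B\<close> show "x \<in> {x. g x < m} \<inter> B"
        by simp
    qed
    moreover have "?\<mu> ({x. g x \<le> t} \<inter> B) \<le> ?\<mu> B / 2" if "t < m" for t
    proof -
      \<comment> \<open>Below \<open>m\<close> the strict superlevel set fills more than half of
        \<open>B\<close>, so its complement in \<open>B\<close> fills less than half.\<close>
      have "?\<mu> ({x. g x \<le> t} \<inter> B) = ?\<mu> (B - {x. t < g x} \<inter> B)"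
        by (rule arg_cong[where f="?\<mu>"]) auto
      also have "\<dots> = ?\<mu> B - F t"
        unfolding F_def using fm[of UNIV] by (intro measurable_measure_Diff) auto
      finally show ?thesis
        using below[OF that] by simp
    qed
    ultimately show ?thesis
      by (intro LIMSEQ_le_const2[where X="\<lambda>n. ?\<mu> ({x. g x \<le> m - 1 / real (Suc n)} \<inter> B)"]) auto
  qed
  ultimately show thesis
    by (rule that)
qed

section \<open>Lebesgue points\<close>

text \<open>Chebyshev's inequality: on \<open>{y. g y \<le> t}\<close> the integrand
  \<open>\<bar>g y - a\<bar>\<close> is at least \<open>a - t\<close>, while its mean over a small
  ball is below \<open>(a - t) / 2\<close>.\<close>

lemma eventually_superlevel_majority:
  fixes g :: "'a::euclidean_space \<Rightarrow> real"
  assumes "open \<Omega>" "x \<in> \<Omega>" and g [measurable]: "g \<in> borel_measurable borel"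
    and int: "g absolutely_integrable_on \<Omega>"
    and leb: "is_lebesgue_value g x a" and "t < a"
  shows "\<forall>\<^sub>F r in at_right 0. measure lborel (ball x r) / 2 < measure lborel ({y. t < g y} \<inter> ball x r)"
proof -
  have "\<forall>\<^sub>F r in at_right 0. (LINT y:ball x r|lebesgue. \<bar>g y - a\<bar>) / measure lebesgue (ball x r) < (a - t) / 2"
    using leb \<open>t < a\<close> unfolding is_lebesgue_value_def by (intro order_tendstoD(2)) auto
  moreover obtain e where "0 < e" "ball x e \<subseteq> \<Omega>"
    using assms(1,2) open_contains_ball by blast
  then have "\<forall>\<^sub>F r in at_right 0. ball x r \<subseteq> \<Omega> \<and> 0 < r"
    unfolding eventually_at_right_field by (intro exI[of _ e]) (auto dest: less_imp_le)
  ultimately show ?thesis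
  proof eventually_elim
    case (elim r)
    let ?B = "ball x r"
    have B: "0 < measure lborel ?B"
      using elim by (simp add: content_ball_pos)
    have fm: "S \<inter> ?B \<in> fmeasurable lborel" if "S \<in> sets borel" for S
      using that emeasure_bounded_finite[of "S \<inter> ?B"] by (intro fmeasurableI) (auto simp: bounded_Int)
    have [measurable]: "{y. g y \<le> t} \<in> sets borel" "{y. t < g y} \<in> sets borel"
      by measurable
    \<comment> \<open>Integrability matters here: the integral of a nonintegrable function is 0 by
      default and would say nothing about \<open>g\<close>.\<close>
    have "g absolutely_integrable_on ?B"
      using elim by (intro set_integrable_subset[OF int]) auto
    then have "(\<lambda>y. g y - a) absolutely_integrable_on ?B"
      by (intro set_integral_diff(1) absolutely_integrable_on_const) auto
    then have I: "integrable lebesgue (\<lambda>y. indicator ?B y *\<^sub>R \<bar>g y - a\<bar>)"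
      unfolding set_integrable_def[symmetric] by (rule set_integrable_abs)
    have int_S: "(\<integral>y. indicator ({y. g y \<le> t} \<inter> ?B) y \<partial>lebesgue) = measure lborel ({y. g y \<le> t} \<inter> ?B)"
      by simp
    have "(a - t) * measure lborel ({y. g y \<le> t} \<inter> ?B) = (\<integral>y. (a - t) * indicator ({y. g y \<le> t} \<inter> ?B) y \<partial>lebesgue)"
      by (simp only: integral_mult_right_zero int_S)
    also have "\<dots> \<le> (\<integral>y. indicator ?B y *\<^sub>R \<bar>g y - a\<bar> \<partial>lebesgue)"
    proof (rule integral_mono[OF _ I])
      show "integrable lebesgue (\<lambda>y. (a - t) * indicator ({y. g y \<le> t} \<inter> ?B) y)"
        using fm[of "{y. g y \<le> t}"] by (intro integrable_mult_right) (auto simp: fmeasurable_def)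
      show "(a - t) * indicator ({y. g y \<le> t} \<inter> ?B) y \<le> indicator ?B y *\<^sub>R \<bar>g y - a\<bar>" for y
        by (auto simp: indicator_def)
    qed
    also have "\<dots> < (a - t) / 2 * measure lborel ?B"
      using elim(1) B by (simp add: set_lebesgue_integral_def divide_less_eq)
    also have "\<dots> = (a - t) * (measure lborel ?B / 2)"
      by simp
    finally have "measure lborel ({y. g y \<le> t} \<inter> ?B) < measure lborel ?B / 2"
      using \<open>t < a\<close> by (simp only: mult_less_cancel_left)
    moreover have "measure lborel ?B = measure lborel (({y. g y \<le> t} \<inter> ?B) \<union> ({y. t < g y} \<inter> ?B))"
      by (rule arg_cong[where f="measure lborel"]) auto
    then have "measure lborel ?B = measure lborel ({y. g y \<le> t} \<inter> ?B) + measure lborel ({y. t < g y} \<inter> ?B)"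
      using fm by (subst (asm) measure_Un2[of _ lborel]) (auto intro!: arg_cong[where f="measure lborel"])
    ultimately show ?case
      by linarith
  qed
qed

lemma is_lebesgue_value_uminus:
  "is_lebesgue_value (\<lambda>x. - g x) x (- a) \<longleftrightarrow> is_lebesgue_value g x a"
proof -
  have "\<bar>- g y - - a\<bar> = \<bar>g y - a\<bar>" for y
    by simp
  then show ?thesis
    unfolding is_lebesgue_value_def by (simp only:)
qed

text \<open>Two values would give, at their midpoint \<open>t\<close>, disjoint sets
  \<open>{y. t < g y}\<close> and \<open>{y. g y < t}\<close> that both fill more than half of a
  small ball. Hence the definite description is well defined.\<close>

lemma precise_rep_eq:
  fixes g :: "'a::euclidean_space \<Rightarrow> real"
  assumes "open \<Omega>" "x \<in> \<Omega>" and g: "g \<in> borel_measurable borel"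
    and int: "g absolutely_integrable_on \<Omega>" and a: "is_lebesgue_value g x a"
  shows "precise_rep g x = a"
proof -
  have no: False if "is_lebesgue_value g x b" "is_lebesgue_value g x c" "b < c" for b c
  proof -
    define t where "t = (b + c) / 2"
    have t: "t < c" "- t < - b"
      using that(3) by (auto simp: t_def)
    have mg: "(\<lambda>x. - g x) \<in> borel_measurable borel"
      using g by measurable
    have mint: "(\<lambda>x. - g x) absolutely_integrable_on \<Omega>"
      using int by (simp add: set_integrable_def)
    have "\<forall>\<^sub>F r in at_right 0. measure lborel (ball x r) / 2 < measure lborel ({y. t < g y} \<inter> ball x r)"
      by (rule eventually_superlevel_majority[OF assms(1,2) g int that(2) t(1)])
    moreover have "\<forall>\<^sub>F r in at_right 0. measure lborel (ball x r) / 2 < measure lborel ({y. - t < - g y} \<inter> ball x r)"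
      using that(1) by (intro eventually_superlevel_majority[OF assms(1,2) mg mint _ t(2)]) (simp add: is_lebesgue_value_uminus)
    ultimately have "\<forall>\<^sub>F r in at_right (0 :: real). False"
    proof eventually_elim
      case (elim r)
      have fm: "S \<inter> ball x r \<in> fmeasurable lborel" if "S \<in> sets borel" for S
        using that emeasure_bounded_finite[of "S \<inter> ball x r"] by (intro fmeasurableI) (auto simp: bounded_Int)
      have S: "{y. t < g y} \<in> sets borel" "{y. - t < - g y} \<in> sets borel"
        using g by measurable
      have "measure lborel ({y. t < g y} \<inter> ball x r) + measure lborel ({y. - t < - g y} \<inter> ball x r)
        = measure lborel (({y. t < g y} \<inter> ball x r) \<union> ({y. - t < - g y} \<inter> ball x r))"
        using fm[OF S(1)] fm[OF S(2)]
        by (subst measure_Un2) (auto intro!: arg_cong[where f="measure lborel"])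
      also have "\<dots> \<le> measure lborel (ball x r)"
        using fm[of UNIV] S by (intro measure_mono_fmeasurable) auto
      finally show False
        using elim by linarith
    qed
    then show False
      by simp
  qed
  show ?thesis
    unfolding precise_rep_def
  proof (rule the_equality)
    show "is_lebesgue_value g x a"
      by (rule a)
  next
    fix b assume "is_lebesgue_value g x b"
    then show "b = a"
      using no[of a b] no[of b a] a by (cases b a rule: linorder_cases) auto
  qed
qed

lemma superlevel_subset_dense_points:
  fixes g :: "'a::euclidean_space \<Rightarrow> real"
  assumes "open \<Omega>" and pos: "\<And>x. x \<in> \<Omega> \<Longrightarrow> 0 < bdist \<Omega> x" and "0 < \<kappa>" and g: "g \<in> borel_measurable borel"
    and int: "g absolutely_integrable_on \<Omega>"
    and x: "x \<in> \<Omega>" "is_lebesgue_value g x a" and t: "t < a"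
  shows "x \<in> dense_points \<kappa> \<Omega> {y. t < g y}"
proof -
  have "\<forall>\<^sub>F r in at_right 0. 0 < r \<and> r < \<kappa> * bdist \<Omega> x"
    using pos[OF x(1)] \<open>0 < \<kappa>\<close> unfolding eventually_at_right_field by (intro exI[of _ "\<kappa> * bdist \<Omega> x"]) auto
  with eventually_superlevel_majority[OF assms(1) x(1) g int x(2) t]
  have "\<forall>\<^sub>F r in at_right 0. 0 < r \<and> r < \<kappa> * bdist \<Omega> x \<and>
      measure lborel (ball x r) / 2 < measure lborel ({y. t < g y} \<inter> ball x r)"
    by eventually_elim auto
  then obtain r where "0 < r \<and> r < \<kappa> * bdist \<Omega> x \<and>
      measure lborel (ball x r) / 2 < measure lborel ({y. t < g y} \<inter> ball x r)"
    using eventually_happens[of _ "at_right (0::real)"] by (auto simp: trivial_limit_at_right_real)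
  then show ?thesis
    using x by (auto simp: dense_points_def intro!: exI[of _ r])
qed

section \<open>The Choquet integral estimate\<close>

lemma frac_energy_uminus: "frac_energy \<tau> \<delta> \<Omega> (\<lambda>x. - g x) = frac_energy \<tau> \<delta> \<Omega> g"
proof -
  have "\<bar>- g x - - g y\<bar> = \<bar>g x - g y\<bar>" for x y by linarith
  then show ?thesis
    unfolding frac_energy_def by (simp only:)
qed

lemma hausdorff_content_le_of_subset_ball:
  assumes "A \<subseteq> ball c r"
  shows "hausdorff_content \<alpha> A \<le> ennreal (unit_ball_vol \<alpha> * max 0 r powr \<alpha>)"
proof -
  have "ball c r \<subseteq> ball c (max 0 r)"
    by (intro subset_ball) auto
  then have "hausdorff_content \<alpha> A \<le> (\<integral>\<^sup>+i. ennreal (unit_ball_vol \<alpha> * max 0 r powr \<alpha>) \<partial>count_space {()})"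
    using assms by (intro hausdorff_content_le_countable_cover[where c="\<lambda>_. c"]) auto
  then show ?thesis
    by (simp add: nn_integral_count_space_finite)
qed

text \<open>Layer cake on both sides of \<open>m\<close>. The unusual form \<open>t + - m\<close> is
  the pattern \<open>t + c\<close> of the coarea lemmas, applied to \<open>- g\<close>.\<close>

lemma nn_integral_abs_diff_eq_superlevels:
  fixes g :: "'a::euclidean_space \<Rightarrow> real"
  assumes [measurable]: "g \<in> borel_measurable borel" "\<Omega> \<in> sets borel"
  shows "(\<integral>\<^sup>+x\<in>\<Omega>. ennreal \<bar>g x - m\<bar> \<partial>lborel) =
    (\<integral>\<^sup>+t\<in>{0..}. (emeasure lborel ({x. t + m < g x} \<inter> \<Omega>) + emeasure lborel ({x. t + - m < - g x} \<inter> \<Omega>)) \<partial>lborel)"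
proof -
  define k :: "real \<Rightarrow> 'a \<Rightarrow> ennreal" where
    "k t x = ((if t + m < g x then 1 else 0) + (if t + - m < - g x then 1 else 0)) * (if 0 \<le> t then 1 else 0) * indicator \<Omega> x" for t x
  have [measurable]: "(\<lambda>(t, x). k t x) \<in> borel_measurable (borel \<Otimes>\<^sub>M borel)"
    unfolding k_def by measurable
  have 1: "(\<integral>\<^sup>+t. k t x \<partial>lborel) = ennreal \<bar>g x - m\<bar> * indicator \<Omega> x" for x
  proof -
    \<comment> \<open>For \<open>0 \<le> t\<close> the two strict conditions exclude each other, so
      their sum is a single indicator.\<close>
    have "(\<integral>\<^sup>+t. k t x \<partial>lborel) = (\<integral>\<^sup>+t. indicator \<Omega> x * indicator {0..<\<bar>g x - m\<bar>} t \<partial>lborel)"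
      by (intro nn_integral_cong) (auto simp: k_def indicator_def)
    also have "\<dots> = indicator \<Omega> x * ennreal \<bar>g x - m\<bar>"
      by (subst nn_integral_cmult_indicator) auto
    finally show ?thesis
      by (simp add: mult.commute)
  qed
  have 2: "(\<integral>\<^sup>+x. k t x \<partial>lborel) =
    (emeasure lborel ({x. t + m < g x} \<inter> \<Omega>) + emeasure lborel ({x. t + - m < - g x} \<inter> \<Omega>)) * indicator {0..} t" for t
  proof -
    have "(\<integral>\<^sup>+x. k t x \<partial>lborel) = (\<integral>\<^sup>+x. (indicator ({x. t + m < g x} \<inter> \<Omega>) x + indicator ({x. t + - m < - g x} \<inter> \<Omega>) x) * indicator {0..} t \<partial>lborel)"
      by (intro nn_integral_cong) (auto simp: k_def indicator_def)
    also have "\<dots> = (emeasure lborel ({x. t + m < g x} \<inter> \<Omega>) + emeasure lborel ({x. t + - m < - g x} \<inter> \<Omega>)) * indicator {0..} t"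
      by (simp add: nn_integral_multc nn_integral_add)
    finally show ?thesis .
  qed
  have "(\<integral>\<^sup>+x. \<integral>\<^sup>+t. k t x \<partial>lborel \<partial>lborel) = (\<integral>\<^sup>+t. \<integral>\<^sup>+x. k t x \<partial>lborel \<partial>lborel)"
    by (rule lborel_pair.Fubini') measurable
  then show ?thesis
    by (simp only: 1 2)
qed

lemma lebesgue_value_levels:
  fixes g :: "'a::euclidean_space \<Rightarrow> real"
  assumes \<Omega>: "open \<Omega>" "\<And>x. x \<in> \<Omega> \<Longrightarrow> 0 < bdist \<Omega> x" and "0 < \<kappa>"
    and g [measurable]: "g \<in> borel_measurable borel" and int: "g absolutely_integrable_on \<Omega>"
  shows "{x \<in> lebesgue_points \<Omega> g. u < \<bar>precise_rep g x - m\<bar>}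
    \<subseteq> dense_points \<kappa> \<Omega> {x. u + m < g x} \<union> dense_points \<kappa> \<Omega> {x. u + - m < - g x}"
proof
  fix x assume "x \<in> {x \<in> lebesgue_points \<Omega> g. u < \<bar>precise_rep g x - m\<bar>}"
  then obtain a where a: "x \<in> \<Omega>" "is_lebesgue_value g x a" "u < \<bar>a - m\<bar>"
    using precise_rep_eq[OF \<Omega>(1) _ g int] by (auto simp: lebesgue_points_def)
  have mg: "(\<lambda>x. - g x) \<in> borel_measurable borel"
    by measurable
  have mint: "(\<lambda>x. - g x) absolutely_integrable_on \<Omega>"
    using int by (simp add: set_integrable_def)
  consider "u + m < a" | "u + - m < - a"
    using a(3) by linarith
  then show "x \<in> dense_points \<kappa> \<Omega> {x. u + m < g x} \<union> dense_points \<kappa> \<Omega> {x. u + - m < - g x}"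
  proof cases
    case 1
    then show ?thesis
      using superlevel_subset_dense_points[OF \<Omega> \<open>0 < \<kappa>\<close> g int a(1,2)] by blast
  next
    case 2
    then show ?thesis
      using superlevel_subset_dense_points[OF \<Omega> \<open>0 < \<kappa>\<close> mg mint a(1), of "- a"] a(2)
      by (simp add: is_lebesgue_value_uminus)
  qed
qed

lemma nn_integral_level_energies:
  fixes g :: "'a::euclidean_space \<Rightarrow> real"
  assumes "open \<Omega>" and [measurable]: "g \<in> borel_measurable borel"
  shows "(\<integral>\<^sup>+t. (frac_energy \<tau> \<delta> \<Omega> (indicator {x. t + c < g x}) + frac_energy \<tau> \<delta> \<Omega> (indicator {x. t + c' < - g x})) \<partial>lborel)
    = 2 * frac_energy \<tau> \<delta> \<Omega> g"
proof -
  have mg: "(\<lambda>x. - g x) \<in> borel_measurable borel"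
    by measurable
  note [measurable] = borel_measurable_frac_energy_level[OF assms(1,2)] borel_measurable_frac_energy_level[OF assms(1) mg]
  show ?thesis
    by (simp add: nn_integral_add frac_energy_coarea[OF assms] frac_energy_coarea[OF assms(1) mg] frac_energy_uminus mult_2)
qed

text \<open>Boxing is used twice. With exponent \<open>n\<close> it bounds the gap \<open>b\<close>
  between mean and median; with the exponent of the Choquet integral it bounds the contents of the
  levels beyond the median. Levels are measured from the mean, so they are shifted by
  \<open>b\<close>, and those below \<open>b\<close> are paid for by the bound on
  \<open>b\<close>.\<close>

lemma choquet_integral_Borel_le:
  fixes \<tau> s C D :: real
  assumes \<tau>: "0 < \<tau>" "\<tau> < 1" and s: "1 \<le> s" and C: "1 \<le> C" and D: "0 < D"
  obtains K where "0 < K" "\<And>\<delta> \<Omega> x\<^sub>J (g :: 'a::euclidean_space \<Rightarrow> real).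
    john_domain_with_center s C x\<^sub>J \<Omega> \<Longrightarrow> diameter \<Omega> = D \<Longrightarrow> 0 < \<delta> \<Longrightarrow> \<delta> < 1 \<Longrightarrow>
    s * (real DIM('a) - \<delta>) \<le> real DIM('a) \<Longrightarrow> g \<in> borel_measurable borel \<Longrightarrow> g absolutely_integrable_on \<Omega> \<Longrightarrow>
    choquet_integral (s * (real DIM('a) - \<delta>)) (lebesgue_points \<Omega> g) (\<lambda>x. precise_rep g x - mean_value \<Omega> g)
      \<le> ennreal (K * (1 - \<delta>)) * frac_energy \<tau> \<delta> \<Omega> g"
proof -
  let ?n = "real DIM('a)"
  obtain K where K: "0 < K" and box: "\<And>\<delta> \<alpha> \<Omega> x\<^sub>J (E :: 'a set).
    john_domain_with_center s C x\<^sub>J \<Omega> \<Longrightarrow> diameter \<Omega> = D \<Longrightarrow> E \<in> sets borel \<Longrightarrow> 0 < \<delta> \<Longrightarrow> \<delta> < 1 \<Longrightarrow>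
    s * (?n - \<delta>) \<le> \<alpha> \<Longrightarrow> \<alpha> \<le> ?n \<Longrightarrow>
    measure lborel (E \<inter> ball x\<^sub>J (\<tau> / 4 * bdist \<Omega> x\<^sub>J)) \<le> measure lborel (ball x\<^sub>J (\<tau> / 4 * bdist \<Omega> x\<^sub>J)) / 2 \<Longrightarrow>
    hausdorff_content \<alpha> (dense_points (\<tau> / 4) \<Omega> E) \<le> ennreal (K * (1 - \<delta>)) * frac_energy \<tau> \<delta> \<Omega> (indicator E)"
    using boxing_inequality[OF \<tau> s, where 'a='a] by blast
  obtain U where U: "0 < U" "\<And>\<alpha>. 0 \<le> \<alpha> \<Longrightarrow> \<alpha> \<le> ?n \<Longrightarrow> unit_ball_vol \<alpha> \<le> U"
    using unit_ball_vol_bounded[of ?n] by blast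
  \<comment> \<open>\<open>H\<close> bounds the content of \<open>\<Omega>\<close> for all exponents
    in question. \<open>v\<close> is the volume of a ball about the center whose radius the John
    condition forces into \<open>\<Omega>\<close>. Neither depends on
    \<open>\<delta>\<close>.\<close>
  define H where "H = U * max 1 (2 * D) powr ?n"
  define v where "v = unit_ball_vol ?n * ((D / 4) powr s / C) ^ DIM('a)"
  have H: "0 < H" using U by (simp add: H_def)
  have v: "0 < v" using D C by (simp add: v_def)
  show thesis
  \<comment> \<open>The summands account for the levels below and above the gap between mean and
    median; each 2 stems from the two families of level sets, of \<open>g\<close> and of
    \<open>- g\<close>.\<close>
  proof (rule that[of "H / v * (2 * K) + 2 * K"])
    show "0 < H / v * (2 * K) + 2 * K"
      using H v K by (intro add_pos_pos mult_pos_pos divide_pos_pos) auto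
    fix \<delta> :: real and \<Omega> x\<^sub>J and g :: "'a \<Rightarrow> real"
    assume J: "john_domain_with_center s C x\<^sub>J \<Omega>" and dD: "diameter \<Omega> = D" and \<delta>: "0 < \<delta>" "\<delta> < 1"
      and \<alpha>n: "s * (?n - \<delta>) \<le> ?n" and g [measurable]: "g \<in> borel_measurable borel"
      and int: "g absolutely_integrable_on \<Omega>"
    define \<alpha> where "\<alpha> = s * (?n - \<delta>)"
    define X where "X = frac_energy \<tau> \<delta> \<Omega> g"
    have \<alpha>: "0 \<le> \<alpha>" "\<alpha> \<le> ?n"
    proof -
      have "0 \<le> ?n - \<delta>"
        using \<delta> DIM_positive[where 'a='a] by linarith
      then show "0 \<le> \<alpha>"
        using s by (simp add: \<alpha>_def)
      show "\<alpha> \<le> ?n"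
        using \<alpha>n by (simp only: \<alpha>_def)
    qed
    have \<Omega>: "open \<Omega>" "x\<^sub>J \<in> \<Omega>" "bounded \<Omega>"
      using J by (auto simp: john_domain_with_center_def domain_def)
    have [measurable]: "\<Omega> \<in> sets borel" using \<Omega> by simp
    have pos: "0 < bdist \<Omega> x" if "x \<in> \<Omega>" for x
      by (rule john_bdist_pos[OF J that])
    let ?B = "ball x\<^sub>J (\<tau> / 4 * bdist \<Omega> x\<^sub>J)"
    have "0 < measure lborel ?B"
      using pos[OF \<Omega>(2)] \<tau> by (simp add: content_ball_pos)
    then obtain m where m: "measure lborel ({x. m < g x} \<inter> ?B) \<le> measure lborel ?B / 2"
      "measure lborel ({x. g x < m} \<inter> ?B) \<le> measure lborel ?B / 2"
      using median_exists[OF g, of ?B] by auto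
    have fm: "S \<inter> ?B \<in> fmeasurable lborel" if "S \<in> sets borel" for S
      using that emeasure_bounded_finite[of "S \<inter> ?B"] by (intro fmeasurableI) (auto simp: bounded_Int)
    \<comment> \<open>Levels beyond the median on either side give subsets of the two sets in
      \<open>m\<close>, which is the sparseness that boxing requires.\<close>
    have sp: "measure lborel ({x. u + m < g x} \<inter> ?B) \<le> measure lborel ?B / 2"
      "measure lborel ({x. u + - m < - g x} \<inter> ?B) \<le> measure lborel ?B / 2" if "0 \<le> u" for u
    proof -
      have S [measurable]: "{x. u + m < g x} \<in> sets borel" "{x. u + - m < - g x} \<in> sets borel"
          "{x. m < g x} \<in> sets borel" "{x. g x < m} \<in> sets borel"
        by measurable
      have "measure lborel ({x. u + m < g x} \<inter> ?B) \<le> measure lborel ({x. m < g x} \<inter> ?B)"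
        using that fm[OF S(3)] fm[OF S(1)] by (intro measure_mono_fmeasurable) (auto dest: fmeasurableD)
      then show "measure lborel ({x. u + m < g x} \<inter> ?B) \<le> measure lborel ?B / 2"
        using m(1) by linarith
      have "measure lborel ({x. u + - m < - g x} \<inter> ?B) \<le> measure lborel ({x. g x < m} \<inter> ?B)"
        using that fm[OF S(4)] fm[OF S(2)] by (intro measure_mono_fmeasurable) (auto dest: fmeasurableD)
      then show "measure lborel ({x. u + - m < - g x} \<inter> ?B) \<le> measure lborel ?B / 2"
        using m(2) by linarith
    qed
    define P where "P u = frac_energy \<tau> \<delta> \<Omega> (indicator {x. u + m < g x}) + frac_energy \<tau> \<delta> \<Omega> (indicator {x. u + - m < - g x})" for u
    have content: "hausdorff_content \<beta> (dense_points (\<tau> / 4) \<Omega> {x. u + m < g x}) +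
        hausdorff_content \<beta> (dense_points (\<tau> / 4) \<Omega> {x. u + - m < - g x}) \<le> ennreal (K * (1 - \<delta>)) * P u"
      if "\<alpha> \<le> \<beta>" "\<beta> \<le> ?n" "0 \<le> u" for \<beta> u
      unfolding P_def distrib_left
      using that unfolding \<alpha>_def by (intro add_mono box[OF J dD _ \<delta>] sp) measurable
    have intP: "(\<integral>\<^sup>+t. P (t + c) \<partial>lborel) = 2 * X" for c
      using nn_integral_level_energies[OF \<Omega>(1) g, of \<tau> \<delta> "c + m" "c + - m"]
      unfolding P_def X_def by (simp only: add.assoc)
    have mg: "(\<lambda>x. - g x) \<in> borel_measurable borel"
      by measurable
    note [measurable] = borel_measurable_frac_energy_level[OF \<Omega>(1) g] borel_measurable_frac_energy_level[OF \<Omega>(1) mg]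
    have P_meas: "(\<lambda>t. P (t + c)) \<in> borel_measurable borel" for c
      unfolding P_def add.assoc by measurable
    define b where "b = \<bar>mean_value \<Omega> g - m\<bar>"
    have \<Omega>f: "\<Omega> \<in> lmeasurable"
      using \<Omega> by (intro bounded_set_imp_lmeasurable) auto
    have "ball x\<^sub>J ((D / 4) powr s / C) \<subseteq> ball x\<^sub>J (bdist \<Omega> x\<^sub>J)"
      using john_bdist_center_ge[OF J] C by (intro subset_ball) (simp add: dD divide_le_eq mult.commute)
    then have "ball x\<^sub>J ((D / 4) powr s / C) \<subseteq> \<Omega>"
      using ball_bdist_subset[OF \<Omega>(2)] by blast
    then have "emeasure lborel (ball x\<^sub>J ((D / 4) powr s / C)) \<le> emeasure lborel \<Omega>"
      by (intro emeasure_mono) auto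
    then have v_le: "ennreal v \<le> emeasure lborel \<Omega>"
      using C by (simp add: emeasure_ball v_def)
    have e\<Omega>: "emeasure lborel \<Omega> = ennreal (measure lebesgue \<Omega>)"
      using emeasure_eq_measure2[OF \<Omega>f] by simp
    have m\<Omega>: "0 < measure lebesgue \<Omega>"
    proof -
      have "v \<le> measure lebesgue \<Omega>"
        using v_le unfolding e\<Omega> by (subst (asm) ennreal_le_iff) auto
      then show ?thesis using v by linarith
    qed
    \<comment> \<open>The integral of \<open>g - m\<close> over \<open>\<Omega>\<close> is the mean
      minus \<open>m\<close>, times the measure of \<open>\<Omega>\<close>.\<close>
    have "ennreal b * emeasure lborel \<Omega> \<le> (\<integral>\<^sup>+x\<in>\<Omega>. ennreal \<bar>g x - m\<bar> \<partial>lborel)"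
    proof -
      have c: "(\<lambda>_. m) absolutely_integrable_on \<Omega>"
        using \<Omega>f by (rule absolutely_integrable_on_const)
      have "(LINT x:\<Omega>|lebesgue. g x - m) = (LINT x:\<Omega>|lebesgue. g x) - (LINT x:\<Omega>|lebesgue. m)"
        by (rule set_integral_diff(2)[OF int c])
      also have "(LINT x:\<Omega>|lebesgue. m) = m * measure lebesgue \<Omega>"
        using \<Omega>f by (simp add: set_lebesgue_integral_def)
      finally have "b * measure lebesgue \<Omega> = \<bar>LINT x:\<Omega>|lebesgue. g x - m\<bar>"
        using m\<Omega> by (simp add: b_def mean_value_def abs_mult field_simps flip: abs_mult_pos')
      then have "ennreal b * emeasure lborel \<Omega> = ennreal (norm (\<integral>x. indicator \<Omega> x *\<^sub>R (g x - m) \<partial>lebesgue))"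
        unfolding e\<Omega> by (subst ennreal_mult[symmetric]) (auto simp: b_def set_lebesgue_integral_def)
      also have "\<dots> \<le> (\<integral>\<^sup>+x. norm (indicator \<Omega> x *\<^sub>R (g x - m)) \<partial>lebesgue)"
        using set_integral_diff(1)[OF int c] unfolding set_integrable_def by (rule integral_norm_bound_ennreal)
      also have "\<dots> = (\<integral>\<^sup>+x\<in>\<Omega>. ennreal \<bar>g x - m\<bar> \<partial>lborel)"
        unfolding nn_integral_completion by (intro nn_integral_cong) (auto simp: indicator_def)
      finally show ?thesis .
    qed
    also have "\<dots> = (\<integral>\<^sup>+t\<in>{0..}. (emeasure lborel ({x. t + m < g x} \<inter> \<Omega>) + emeasure lborel ({x. t + - m < - g x} \<inter> \<Omega>)) \<partial>lborel)"
      by (rule nn_integral_abs_diff_eq_superlevels) measurable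
    also have "\<dots> \<le> (\<integral>\<^sup>+t. ennreal (K * (1 - \<delta>)) * P (t + 0) \<partial>lborel)"
    proof (intro nn_integral_mono)
      fix t :: real
      show "(emeasure lborel ({x. t + m < g x} \<inter> \<Omega>) + emeasure lborel ({x. t + - m < - g x} \<inter> \<Omega>)) * indicator {0..} t
          \<le> ennreal (K * (1 - \<delta>)) * P (t + 0)"
      proof (cases "0 \<le> t")
        case True
        have "emeasure lborel ({x. t + m < g x} \<inter> \<Omega>) + emeasure lborel ({x. t + - m < - g x} \<inter> \<Omega>) \<le>
          hausdorff_content ?n (dense_points (\<tau> / 4) \<Omega> {x. t + m < g x}) +
          hausdorff_content ?n (dense_points (\<tau> / 4) \<Omega> {x. t + - m < - g x})"
          using pos \<tau> \<Omega>(1) by (intro add_mono emeasure_le_hausdorff_content_dense_points) auto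
        also have "\<dots> \<le> ennreal (K * (1 - \<delta>)) * P t"
          using content[of ?n t] \<alpha> True by simp
        finally show ?thesis
          using True by simp
      qed simp
    qed
    also have "\<dots> = ennreal (K * (1 - \<delta>)) * (2 * X)"
      using P_meas[of 0] by (subst nn_integral_cmult) (simp, simp only: intP)
    finally have b_le: "ennreal b * ennreal v \<le> ennreal (K * (1 - \<delta>)) * (2 * X)"
      using v_le by (meson mult_left_mono order_trans zero_le)
    have Hle: "hausdorff_content \<alpha> \<Omega> \<le> ennreal H"
    proof -
      have "dist x\<^sub>J x < 2 * D" if "x \<in> \<Omega>" for x
        using diameter_bounded_bound[OF \<Omega>(3,2) that] D dD by linarith
      then have "\<Omega> \<subseteq> ball x\<^sub>J (2 * D)"
        by auto
      then have "hausdorff_content \<alpha> \<Omega> \<le> ennreal (unit_ball_vol \<alpha> * max 0 (2 * D) powr \<alpha>)"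
        by (rule hausdorff_content_le_of_subset_ball)
      also have "\<dots> \<le> ennreal H"
      proof (intro ennreal_leI)
        have "max 0 (2 * D) powr \<alpha> \<le> max 1 (2 * D) powr \<alpha>"
          using D \<alpha> by (intro powr_mono2) auto
        also have "\<dots> \<le> max 1 (2 * D) powr ?n"
          using \<alpha> by (intro powr_mono) auto
        finally show "unit_ball_vol \<alpha> * max 0 (2 * D) powr \<alpha> \<le> H"
          unfolding H_def using U \<alpha> by (intro mult_mono) auto
      qed
      finally show ?thesis .
    qed
    have "choquet_integral \<alpha> (lebesgue_points \<Omega> g) (\<lambda>x. precise_rep g x - mean_value \<Omega> g) \<le>
      (\<integral>\<^sup>+t. (ennreal H * indicator {0..<b} t + ennreal (K * (1 - \<delta>)) * P (t + - b)) \<partial>lborel)"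
      unfolding choquet_integral_def
    proof (intro nn_integral_mono)
      fix t :: real
      let ?L = "{x \<in> lebesgue_points \<Omega> g. t < \<bar>precise_rep g x - mean_value \<Omega> g\<bar>}"
      consider "t < 0" | "0 \<le> t" "t < b" | "0 \<le> t" "b \<le> t" by linarith
      then show "hausdorff_content \<alpha> ?L * indicator {0..} t \<le> ennreal H * indicator {0..<b} t + ennreal (K * (1 - \<delta>)) * P (t + - b)"
      proof cases
        \<comment> \<open>Below \<open>b\<close> the trivial bound by the content of all of
          \<open>\<Omega>\<close> is used; its integral over \<open>t\<close> is at most
          \<open>H * b\<close>.\<close>
        case 2
        have "hausdorff_content \<alpha> ?L \<le> hausdorff_content \<alpha> \<Omega>"
          by (intro hausdorff_content_mono) (auto simp: lebesgue_points_def)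
        also note Hle
        finally show ?thesis
          using 2 by (simp add: add_increasing2)
      next
        case 3
        \<comment> \<open>By the triangle inequality, a deviation above \<open>t\<close> from the
          mean forces one above \<open>t - b\<close> from the median.\<close>
        have "?L \<subseteq> {x \<in> lebesgue_points \<Omega> g. t + - b < \<bar>precise_rep g x - m\<bar>}"
          unfolding b_def by auto
        also have "\<dots> \<subseteq> dense_points (\<tau> / 4) \<Omega> {x. t + - b + m < g x} \<union> dense_points (\<tau> / 4) \<Omega> {x. t + - b + - m < - g x}"
          using \<tau> by (intro lebesgue_value_levels \<Omega>(1) pos g int) auto
        finally have "hausdorff_content \<alpha> ?L \<le> hausdorff_content \<alpha> (dense_points (\<tau> / 4) \<Omega> {x. t + - b + m < g x} \<union> dense_points (\<tau> / 4) \<Omega> {x. t + - b + - m < - g x})"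
          by (rule hausdorff_content_mono)
        also note hausdorff_content_Un
        also note content[of \<alpha> "t + - b"]
        finally show ?thesis
          using 3 \<alpha> by simp
      qed simp
    qed
    also have "\<dots> = ennreal H * ennreal b + ennreal (K * (1 - \<delta>)) * (2 * X)"
    proof -
      have [measurable]: "(\<lambda>t. P (t + - b)) \<in> borel_measurable lborel"
        using P_meas[of "- b"] by simp
      have "0 \<le> b" by (simp add: b_def)
      have "(\<integral>\<^sup>+t. (ennreal H * indicator {0..<b} t + ennreal (K * (1 - \<delta>)) * P (t + - b)) \<partial>lborel) =
        (\<integral>\<^sup>+t. ennreal H * indicator {0..<b} t \<partial>lborel) + (\<integral>\<^sup>+t. ennreal (K * (1 - \<delta>)) * P (t + - b) \<partial>lborel)"
        by (rule nn_integral_add) measurable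
      also have "(\<integral>\<^sup>+t. ennreal (K * (1 - \<delta>)) * P (t + - b) \<partial>lborel) = ennreal (K * (1 - \<delta>)) * (2 * X)"
        by (subst nn_integral_cmult) (measurable, simp only: intP)
      also have "(\<integral>\<^sup>+t. ennreal H * indicator {0..<b} t \<partial>lborel) = ennreal H * ennreal b"
        using \<open>0 \<le> b\<close> by (subst nn_integral_cmult_indicator) auto
      finally show ?thesis .
    qed
    also have "ennreal H * ennreal b \<le> ennreal (H / v) * (ennreal (K * (1 - \<delta>)) * (2 * X))"
    proof -
      have "ennreal H * ennreal b = ennreal (H / v) * (ennreal b * ennreal v)"
        using H v by (simp add: b_def flip: ennreal_mult)
      also have "\<dots> \<le> ennreal (H / v) * (ennreal (K * (1 - \<delta>)) * (2 * X))"
        by (intro mult_left_mono b_le) simp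
      finally show ?thesis .
    qed
    finally have "choquet_integral \<alpha> (lebesgue_points \<Omega> g) (\<lambda>x. precise_rep g x - mean_value \<Omega> g)
      \<le> ennreal (H / v) * (ennreal (K * (1 - \<delta>)) * (2 * X)) + ennreal (K * (1 - \<delta>)) * (2 * X)"
      by (simp add: add_right_mono)
    also have "\<dots> = ennreal ((H / v * (2 * K) + 2 * K) * (1 - \<delta>)) * X"
    proof -
      define k where "k = K * (1 - \<delta>)"
      have k: "0 \<le> k" "0 \<le> H / v" using K H v \<delta> by (auto simp: k_def)
      have k2: "ennreal k * 2 = ennreal (k * 2)"
        using k(1) ennreal_mult[of k 2] by simp
      have "(H / v * (2 * K) + 2 * K) * (1 - \<delta>) = H / v * (k * 2) + k * 2"
        unfolding k_def distrib_right by (simp only: ac_simps)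
      also have "ennreal \<dots> = ennreal (H / v * (k * 2)) + ennreal (k * 2)"
        using k by (intro ennreal_plus mult_nonneg_nonneg) auto
      also have "ennreal (H / v * (k * 2)) = ennreal (H / v) * ennreal (k * 2)"
        using k by (intro ennreal_mult) auto
      finally have "ennreal ((H / v * (2 * K) + 2 * K) * (1 - \<delta>)) = ennreal (H / v) * (ennreal k * 2) + ennreal k * 2"
        by (simp only: k2)
      then show ?thesis
        by (simp only: k_def distrib_right mult.assoc)
    qed
    finally show "choquet_integral (s * (?n - \<delta>)) (lebesgue_points \<Omega> g) (\<lambda>x. precise_rep g x - mean_value \<Omega> g)
      \<le> ennreal ((H / v * (2 * K) + 2 * K) * (1 - \<delta>)) * frac_energy \<tau> \<delta> \<Omega> g"
      by (simp only: \<alpha>_def X_def)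
  qed
qed

section \<open>Passage from a Lebesgue measurable function to a Borel version\<close>

context
  fixes \<Omega> :: "'a::euclidean_space set" and f g :: "'a \<Rightarrow> real"
  assumes \<Omega>: "open \<Omega>" and int: "f absolutely_integrable_on \<Omega>" and g: "g \<in> borel_measurable borel"
    and ae: "AE x in lebesgue. x \<in> \<Omega> \<longrightarrow> f x = g x"
begin

lemma frac_energy_cong_AE: "frac_energy \<tau> \<delta> \<Omega> f = frac_energy \<tau> \<delta> \<Omega> g"
  unfolding frac_energy_def
proof (rule nn_integral_cong_AE)
  \<comment> \<open>The variables are exchanged one at a time: first \<open>f x\<close> with the
    value at \<open>y\<close> frozen at \<open>g y\<close>, then \<open>f y\<close>.\<close>
  have inner: "(\<integral>\<^sup>+x\<in>{x\<in>\<Omega>. dist x y < \<tau> * bdist \<Omega> y}. ennreal (\<bar>f x - g y\<bar> / dist x y powr (real DIM('a) + \<delta>)) \<partial>lebesgue)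
    = (\<integral>\<^sup>+x\<in>{x\<in>\<Omega>. dist x y < \<tau> * bdist \<Omega> y}. ennreal (\<bar>g x - g y\<bar> / dist x y powr (real DIM('a) + \<delta>)) \<partial>lebesgue)" for y
    using ae by (intro nn_integral_cong_AE) (auto elim!: eventually_mono simp: indicator_def)
  show "AE y in lebesgue. (\<integral>\<^sup>+x\<in>{x\<in>\<Omega>. dist x y < \<tau> * bdist \<Omega> y}. ennreal (\<bar>f x - f y\<bar> / dist x y powr (real DIM('a) + \<delta>)) \<partial>lebesgue) * indicator \<Omega> y
    = (\<integral>\<^sup>+x\<in>{x\<in>\<Omega>. dist x y < \<tau> * bdist \<Omega> y}. ennreal (\<bar>g x - g y\<bar> / dist x y powr (real DIM('a) + \<delta>)) \<partial>lebesgue) * indicator \<Omega> y"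
    using ae
  proof eventually_elim
    case (elim y)
    show ?case
    proof (cases "y \<in> \<Omega>")
      case True
      then have "f y = g y"
        using elim by simp
      then show ?thesis
        by (simp only: inner)
    qed simp
  qed
qed

lemma set_lebesgue_integral_cong_Borel:
  assumes "B \<subseteq> \<Omega>" "B \<in> sets borel" and h: "h \<in> borel_measurable borel"
  shows "(LINT x:B|lebesgue. h (f x)) = (LINT x:B|lebesgue. (h (g x) :: real))"
proof -
  have f_meas: "(\<lambda>x. indicator \<Omega> x *\<^sub>R f x) \<in> borel_measurable lebesgue"
    using int unfolding set_integrable_def by (rule borel_measurable_integrable)
  have g_meas: "g \<in> borel_measurable lebesgue"
    using g by (simp add: measurable_completion)
  have "B \<in> sets lebesgue"
    using assms(2) by simp
  \<comment> \<open>Nothing is known of \<open>f\<close> outside \<open>\<Omega>\<close>. The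
    cut-off function is measurable, as \<open>integral_cong_AE\<close> demands.\<close>
  have "(LINT x:B|lebesgue. h (f x)) = (LINT x:B|lebesgue. h (indicator \<Omega> x *\<^sub>R f x))"
    using assms(1) unfolding set_lebesgue_integral_def by (intro Bochner_Integration.integral_cong) (auto simp: indicator_def)
  also have "\<dots> = (LINT x:B|lebesgue. h (g x))"
    unfolding set_lebesgue_integral_def
  proof (rule integral_cong_AE)
    show "AE x in lebesgue. indicat_real B x *\<^sub>R h (indicat_real \<Omega> x *\<^sub>R f x) = indicat_real B x *\<^sub>R h (g x)"
      using ae assms(1) by (auto elim!: eventually_mono simp: indicator_def)
  qed (intro borel_measurable_scaleR borel_measurable_indicator measurable_compose[OF _ h] f_meas g_meas \<open>B \<in> sets lebesgue\<close>)+
  finally show ?thesis .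
qed

lemma mean_value_cong_AE: "mean_value \<Omega> f = mean_value \<Omega> g"
  using set_lebesgue_integral_cong_Borel[of \<Omega> "\<lambda>x. x"] \<Omega> by (simp add: mean_value_def)

lemma is_lebesgue_value_cong_AE:
  assumes "x \<in> \<Omega>"
  shows "is_lebesgue_value f x a \<longleftrightarrow> is_lebesgue_value g x a"
proof -
  obtain e where "0 < e" "ball x e \<subseteq> \<Omega>"
    using \<Omega> assms open_contains_ball by blast
  then have "\<forall>\<^sub>F r in at_right 0. ball x r \<subseteq> \<Omega>"
    unfolding eventually_at_right_field by (intro exI[of _ e]) (auto dest: less_imp_le)
  then have "\<forall>\<^sub>F r in at_right 0. (LINT y:ball x r|lebesgue. \<bar>f y - a\<bar>) / measure lebesgue (ball x r)
      = (LINT y:ball x r|lebesgue. \<bar>g y - a\<bar>) / measure lebesgue (ball x r)"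
    by eventually_elim (simp add: set_lebesgue_integral_cong_Borel[where h="\<lambda>z. \<bar>z - a\<bar>"])
  then show ?thesis
    unfolding is_lebesgue_value_def by (rule tendsto_cong)
qed

text \<open>Content can be positive on null sets, so equality almost everywhere of the integrands
  would not suffice. Lebesgue points and their values agree at every point of
  \<open>\<Omega>\<close>, because they are determined by integrals over balls.\<close>

lemma choquet_integral_cong_AE:
  "choquet_integral \<alpha> (lebesgue_points \<Omega> f) (\<lambda>x. precise_rep f x - mean_value \<Omega> f)
    = choquet_integral \<alpha> (lebesgue_points \<Omega> g) (\<lambda>x. precise_rep g x - mean_value \<Omega> g)"
proof -
  have "lebesgue_points \<Omega> f = lebesgue_points \<Omega> g"
    using is_lebesgue_value_cong_AE by (auto simp: lebesgue_points_def)
  moreover have "precise_rep f x = precise_rep g x" if "x \<in> lebesgue_points \<Omega> g" for x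
    using is_lebesgue_value_cong_AE that by (simp add: precise_rep_def lebesgue_points_def)
  ultimately have "{x \<in> lebesgue_points \<Omega> f. t < \<bar>precise_rep f x - mean_value \<Omega> f\<bar>} =
    {x \<in> lebesgue_points \<Omega> g. t < \<bar>precise_rep g x - mean_value \<Omega> g\<bar>}" for t
    by (auto simp: mean_value_cong_AE)
  then show ?thesis
    unfolding choquet_integral_def by (simp only:)
qed

lemma absolutely_integrable_cong_AE: "g absolutely_integrable_on \<Omega>"
proof -
  have "integrable lebesgue (\<lambda>x. indicator \<Omega> x *\<^sub>R f x)"
    using int by (simp add: set_integrable_def)
  moreover have "(\<lambda>x. indicator \<Omega> x *\<^sub>R g x) \<in> borel_measurable lebesgue"
    using g \<Omega> by (intro borel_measurable_scaleR borel_measurable_indicator) (auto simp: measurable_completion)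
  moreover have "AE x in lebesgue. indicator \<Omega> x *\<^sub>R f x = indicator \<Omega> x *\<^sub>R g x"
    using ae by (auto elim!: eventually_mono simp: indicator_def)
  ultimately show ?thesis
    unfolding set_integrable_def by (rule integrable_cong_AE_imp)
qed

end

lemma absolutely_integrable_Borel_version:
  fixes f :: "'a::euclidean_space \<Rightarrow> real"
  assumes "f absolutely_integrable_on \<Omega>"
  obtains g where "g \<in> borel_measurable borel" "AE x in lebesgue. x \<in> \<Omega> \<longrightarrow> f x = g x"
proof -
  have "(\<lambda>x. indicator \<Omega> x *\<^sub>R f x) \<in> borel_measurable lebesgue"
    using assms unfolding set_integrable_def by (rule borel_measurable_integrable)
  then obtain g where g: "g \<in> borel_measurable lborel" "AE x in lborel. indicator \<Omega> x *\<^sub>R f x = g x"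
    using completion_ex_borel_measurable_real by blast
  have "AE x in lebesgue. x \<in> \<Omega> \<longrightarrow> f x = g x"
    using AE_completion[OF g(2)] by (auto elim!: eventually_mono)
  with g(1) show thesis
    by (intro that[of g]) auto
qed

theorem theorem1p3:
  fixes \<tau> s C\<^sub>J D :: real
  assumes "CARD('n::finite) \<ge> 2"
    and "0 < \<tau>" and "\<tau> < 1"
    and "1 \<le> s" and "1 \<le> C\<^sub>J"
  shows "\<exists>C>0. \<forall>(\<delta>::real) (\<Omega> :: (real ^ 'n) set) (f :: real ^ 'n \<Rightarrow> real).
     0 < \<delta> \<and> \<delta> < 1 \<and> s \<le> real CARD('n) / (real CARD('n) - \<delta>) \<and>
     john_domain s C\<^sub>J \<Omega> \<and> diameter \<Omega> = D \<and> f absolutely_integrable_on \<Omega> \<longrightarrow>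
     choquet_integral (s * (real CARD('n) - \<delta>)) (lebesgue_points \<Omega> f)
         (\<lambda>x. precise_rep f x - mean_value \<Omega> f)
       \<le> ennreal (C * (1 - \<delta>)) *
         (\<integral>\<^sup>+y\<in>\<Omega>. (\<integral>\<^sup>+x\<in>{x\<in>\<Omega>. dist x y < \<tau> * bdist \<Omega> y}.
              ennreal (\<bar>f x - f y\<bar> / dist x y powr (real CARD('n) + \<delta>)) \<partial>lebesgue) \<partial>lebesgue)"
proof (cases "0 < D")
  case True
  have DIM: "DIM(real ^ 'n) = CARD('n)"
    by simp
  obtain K where K: "0 < K" and bound: "\<And>\<delta> \<Omega> x\<^sub>J (g :: real ^ 'n \<Rightarrow> real).
    john_domain_with_center s C\<^sub>J x\<^sub>J \<Omega> \<Longrightarrow> diameter \<Omega> = D \<Longrightarrow> 0 < \<delta> \<Longrightarrow> \<delta> < 1 \<Longrightarrow>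
    s * (real CARD('n) - \<delta>) \<le> real CARD('n) \<Longrightarrow> g \<in> borel_measurable borel \<Longrightarrow> g absolutely_integrable_on \<Omega> \<Longrightarrow>
    choquet_integral (s * (real CARD('n) - \<delta>)) (lebesgue_points \<Omega> g) (\<lambda>x. precise_rep g x - mean_value \<Omega> g)
      \<le> ennreal (K * (1 - \<delta>)) * frac_energy \<tau> \<delta> \<Omega> g"
    using choquet_integral_Borel_le[OF assms(2-5) True, where 'a="real ^ 'n", unfolded DIM] by blast
  show ?thesis
  proof (intro exI[of _ K] conjI K allI impI)
    fix \<delta> :: real and \<Omega> :: "(real ^ 'n) set" and f :: "real ^ 'n \<Rightarrow> real"
    assume *: "0 < \<delta> \<and> \<delta> < 1 \<and> s \<le> real CARD('n) / (real CARD('n) - \<delta>) \<and>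
     john_domain s C\<^sub>J \<Omega> \<and> diameter \<Omega> = D \<and> f absolutely_integrable_on \<Omega>"
    then obtain x\<^sub>J where J: "john_domain_with_center s C\<^sub>J x\<^sub>J \<Omega>"
      by (auto simp: john_domain_def)
    then have "open \<Omega>"
      by (simp add: john_domain_with_center_def domain_def)
    obtain g where g: "g \<in> borel_measurable borel" "AE x in lebesgue. x \<in> \<Omega> \<longrightarrow> f x = g x"
      using * absolutely_integrable_Borel_version by blast
    have f: "f absolutely_integrable_on \<Omega>"
      using * by simp
    note cong = \<open>open \<Omega>\<close> f g
    have "0 < real CARD('n) - \<delta>"
      using assms(1) * by linarith
    then have "s * (real CARD('n) - \<delta>) \<le> real CARD('n)"
      using * by (simp add: le_divide_eq)
    then have "choquet_integral (s * (real CARD('n) - \<delta>)) (lebesgue_points \<Omega> g) (\<lambda>x. precise_rep g x - mean_value \<Omega> g)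
      \<le> ennreal (K * (1 - \<delta>)) * frac_energy \<tau> \<delta> \<Omega> g"
      using * by (intro bound[OF J] g absolutely_integrable_cong_AE[OF cong]) auto
    then have "choquet_integral (s * (real CARD('n) - \<delta>)) (lebesgue_points \<Omega> f) (\<lambda>x. precise_rep f x - mean_value \<Omega> f)
      \<le> ennreal (K * (1 - \<delta>)) * frac_energy \<tau> \<delta> \<Omega> f"
      by (simp only: choquet_integral_cong_AE[OF cong] frac_energy_cong_AE[OF cong])
    then show "choquet_integral (s * (real CARD('n) - \<delta>)) (lebesgue_points \<Omega> f) (\<lambda>x. precise_rep f x - mean_value \<Omega> f)
      \<le> ennreal (K * (1 - \<delta>)) *
         (\<integral>\<^sup>+y\<in>\<Omega>. (\<integral>\<^sup>+x\<in>{x\<in>\<Omega>. dist x y < \<tau> * bdist \<Omega> y}.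
              ennreal (\<bar>f x - f y\<bar> / dist x y powr (real CARD('n) + \<delta>)) \<partial>lebesgue) \<partial>lebesgue)"
      by (simp only: frac_energy_def DIM)
  qed
next
  case False
  \<comment> \<open>A John domain has positive diameter, so for \<open>D \<le> 0\<close> the claim
    is vacuous and any positive constant serves.\<close>
  then have "\<not> (john_domain s C\<^sub>J \<Omega> \<and> diameter \<Omega> = D)" for \<Omega> :: "(real ^ 'n) set"
    using john_diameter_pos by (auto simp: john_domain_def)
  then show ?thesis
    by (intro exI[of _ 1]) auto
qed

end
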